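(* The Zhu algebra $A(V)$ is isomorphic (as an associative algebra) to $A$.
   Context: Fix an integer $\nu\ge1$ and a nonzero integer $k$. Let $L_C=\bigoplus_{i=1}^{\nu}\mathbb{Z}c_i$, $L_D=\bigoplus_{i=1}^{\nu}\mathbb{Z}d_i$, $L=L_C\oplus L_D$, with symmetric bilinear form $(c_i,d_j)=k\delta_{ij}$, $(c_i,c_j)=(d_i,d_j)=0$. Put $\mathfrak{h}=\mathbb{C}\otimes L$. Let $\hat{\mathfrak{h}}=\mathfrak{h}\otimes\mathbb{C}[t,t^{-1}]\oplus\mathbb{C}c$, $\alpha(n)=\alpha\otimes t^n$, $[\alpha(m),\beta(n)]=m(\alpha,\beta)\delta_{m+n,0}c$, $c$ central, and let $M(1)=S(\mathfrak{h}\otimes t^{-1}\mathbb{C}[t^{-1}])$ be the Fock space with $c=1$. $A$ is the unital associative $\mathbb{C}$-algebra generated by $e_\alpha$ ($\alpha\in L_C$) and $d_i$ ($1\le i\le\nu$) with relations $e_0=1$, $e_{\alpha+\beta}=e_\alpha e_\beta$, $d_ie_\alpha-e_\alpha d_i=(d_i,\alpha)e_\alpha$, $d_id_j=d_jd_i$. $V=M(1)\otimes\mathbb{C}[L_C]$ is the vertex subalgebra of the lattice vertex algebra $V_L$ (basis elements $e^\alpha$, $\alpha\in L_C$, of the group algebra), with vacuum $1\otimes e^0$. On $V$, $\alpha(n)$, $n\ne0$, acts on $M(1)$, $\alpha(0)e^\beta=(\alpha,\beta)e^\beta$, and $e^\alpha$ acts by multiplication. The vertex operators are $$Y(e^\beta,z)=\exp\Big(-\sum_{n<0}\tfrac{\beta(n)}{n}z^{-n}\Big)\exp\Big(-\sum_{n>0}\tfrac{\beta(n)}{n}z^{-n}\Big)e^\beta,$$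 $Y(\alpha_1(-n_1)\cdots\alpha_s(-n_s)e^\alpha,z)=\,:(\partial_{n_1-1}\alpha_1(z))\cdots(\partial_{n_s-1}\alpha_s(z))Y(e^\alpha,z):$ with $\alpha(z)=\sum_{n\in\mathbb{Z}}\alpha(n)z^{-n-1}$, $\partial_n=\frac1{n!}(\frac{\partial}{\partial z})^n$, and normal ordering placing $\alpha(n)$, $n<0$, to the left and $\alpha(n)$, $n\ge0$, to the right. $V=\bigoplus_{n\ge0}V_n$ is graded by weight: $\mathrm{wt}(\alpha_1(-n_1)\cdots\alpha_s(-n_s)e^\alpha)=n_1+\cdots+n_s$. Zhu algebra: $A(V)=V/O(V)$, where, writing $Y(u,z)=\sum_nu_nz^{-n-1}$, $O(V)$ is the span of $$u\circ v=\mathrm{Res}_z\frac{(1+z)^{\mathrm{wt}\,u}}{z^2}Y(u,z)v=\sum_{i\ge0}\binom{\mathrm{wt}\,u}{i}u_{i-2}v$$ for $v\in V$ and homogeneous $u\in V$, and the product is induced by $$u*v=\mathrm{Res}_z\frac{(1+z)^{\mathrm{wt}\,u}}{z}Y(u,z)v=\sum_{i\ge0}\binom{\mathrm{wt}\,u}{i}u_{i-1}v$$ for homogeneous $u$, extended linearly. *)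

theory Defs
  imports
    "HOL-Library.Poly_Mapping"
    "HOL-Library.Multiset"
    "HOL-Library.Product_Plus"
    "HOL-Analysis.Finite_Cartesian_Product"
    "HOL-Algebra.QuotRing"
    "HOL-Algebra.Module"
begin

section \<open>Scalar multiplication and linear extension on finitely supported functions\<close>

definition pm_scale :: "complex \<Rightarrow> ('a \<Rightarrow>\<^sub>0 complex) \<Rightarrow> ('a \<Rightarrow>\<^sub>0 complex)"  (infixr \<open>*\<^sub>p\<close> 75)
  where "a *\<^sub>p p = Poly_Mapping.map ((*) a) p"

lemma lookup_pm_scale [simp]: "Poly_Mapping.lookup (a *\<^sub>p p) x = a * Poly_Mapping.lookup p x"
  unfolding pm_scale_def by transfer (simp add: when_def)

lemma vector_space_pm_scale: "vector_space pm_scale"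
  by unfold_locales (auto intro!: poly_mapping_eqI simp: lookup_add algebra_simps)

definition lin_ext :: "('a \<Rightarrow> ('b \<Rightarrow>\<^sub>0 complex)) \<Rightarrow> ('a \<Rightarrow>\<^sub>0 complex) \<Rightarrow> ('b \<Rightarrow>\<^sub>0 complex)"
  where "lin_ext f u = (\<Sum>x\<in>Poly_Mapping.keys u. Poly_Mapping.lookup u x *\<^sub>p f x)"


section \<open>The lattice and its bilinear form\<close>

text \<open>
  The rank \<open>\<nu>\<close> is the cardinality of the finite type \<open>'n\<close>. The basis of \<open>L\<close> is indexed by
  \<open>'n + 'n\<close>, where \<^term>\<open>Inl i\<close> stands for \<open>c\<^sub>i\<close> and \<^term>\<open>Inr i\<close> for \<open>d\<^sub>i\<close>.
\<close>

type_synonym 'n latC = "int ^ 'n"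
type_synonym 'n cartan = "complex ^ ('n + 'n)"

fun basis_form :: "int \<Rightarrow> 'n + 'n \<Rightarrow> 'n + 'n \<Rightarrow> int" where
  "basis_form k (Inl i) (Inr j) = (if i = j then k else 0)"
| "basis_form k (Inr i) (Inl j) = (if i = j then k else 0)"
| "basis_form k (Inl i) (Inl j) = 0"
| "basis_form k (Inr i) (Inr j) = 0"

definition form :: "int \<Rightarrow> 'n::finite cartan \<Rightarrow> 'n cartan \<Rightarrow> complex" where
  "form k \<alpha> \<beta> = (\<Sum>a\<in>UNIV. \<Sum>b\<in>UNIV. \<alpha> $ a * \<beta> $ b * of_int (basis_form k a b))"

definition bvec :: "'n::finite + 'n \<Rightarrow> 'n cartan" where
  "bvec b = axis b 1"

definition incl_C :: "'n::finite latC \<Rightarrow> 'n cartan" where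
  "incl_C \<beta> = (\<Sum>i\<in>UNIV. of_int (\<beta> $ i) *s bvec (Inl i))"


section \<open>The space \<open>V\<close> and the action of the Heisenberg algebra\<close>

type_synonym 'n voa_basis = "(('n + 'n) \<times> nat) multiset \<times> 'n latC"
type_synonym 'n voa = "'n voa_basis \<Rightarrow>\<^sub>0 complex"

text \<open>
  \<open>M(1)\<close> is the polynomial algebra in the variables \<open>b(-m-1)\<close>, \<open>b\<close> a basis element and
  \<open>m\<close> a natural number; such a variable is encoded as \<open>(b, m)\<close> (note the shift), and a monomial
  as a multiset of variables. Hence \<open>V\<close> has the basis \<open>(M, \<beta>)\<close>, which stands for
  \<open>\<Prod>\<^sub>(\<^sub>b\<^sub>,\<^sub>m\<^sub>)\<^sub>\<in>\<^sub>M b(-m-1) e\<^sup>\<beta>\<close>, and the product on this type given by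
  \<^theory>\<open>HOL-Library.Poly_Mapping\<close> is the product of the commutative algebra
  \<open>M(1) \<otimes> \<complex>[L\<^sub>C]\<close>.
\<close>

definition gexp :: "'n::finite latC \<Rightarrow> 'n voa" where
  "gexp \<beta> = Poly_Mapping.single ({#}, \<beta>) 1"

fun heis_basis :: "int \<Rightarrow> 'n::finite cartan \<Rightarrow> int \<Rightarrow> 'n voa_basis \<Rightarrow> 'n voa" where
  "heis_basis k \<alpha> n (M, \<beta>) =
    (if n < 0 then
       (\<Sum>b\<in>UNIV. Poly_Mapping.single (add_mset (b, nat (-n) - 1) M, \<beta>) (\<alpha> $ b))
     else if n = 0 then
       Poly_Mapping.single (M, \<beta>) (form k \<alpha> (incl_C \<beta>))
     else
       (\<Sum>b\<in>UNIV. Poly_Mapping.single (M - {#(b, nat n - 1)#}, \<beta>)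
          (of_int n * form k \<alpha> (bvec b) * of_nat (count M (b, nat n - 1)))))"

definition heis :: "int \<Rightarrow> 'n::finite cartan \<Rightarrow> int \<Rightarrow> 'n voa \<Rightarrow> 'n voa" where
  "heis k \<alpha> n = lin_ext (heis_basis k \<alpha> n)"


section \<open>Vertex operators\<close>

text \<open>
  A formal distribution \<open>F(z) = \<Sum>\<^sub>s F\<^sub>s z\<^sup>s\<close> with coefficients in \<open>End V\<close> is the function
  \<open>s \<mapsto> F\<^sub>s\<close>. Beware that \<open>F\<^sub>s\<close> is the coefficient of \<open>z\<^sup>s\<close>, not the mode of index \<open>s\<close>.
  In products, for every fixed vector only finitely many terms are nonzero whenever the product
  occurs below, so that \<^const>\<open>Sum_any\<close> is an honest sum.
\<close>

type_synonym 'n distr = "int \<Rightarrow> 'n voa \<Rightarrow> 'n voa"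

definition dmult :: "'n::finite distr \<Rightarrow> 'n distr \<Rightarrow> 'n distr" where
  "dmult F G s v = Sum_any (\<lambda>p. F p (G (s - p) v))"

definition dderiv :: "'n::finite distr \<Rightarrow> 'n distr" where
  "dderiv F s v = of_int (s + 1) *\<^sub>p F (s + 1) v"

definition divided_deriv :: "nat \<Rightarrow> 'n::finite distr \<Rightarrow> 'n distr" where
  "divided_deriv m F s v = (1 / fact m) *\<^sub>p (dderiv ^^ m) F s v"

text \<open>
  The coefficient of \<open>w\<^sup>p\<close> in the \<open>j\<close>-th power, and then in the exponential, of a series
  \<open>X(w) = \<Sum>\<^sub>n\<^sub>\<ge>\<^sub>1 X\<^sub>n w\<^sup>n\<close> of operators. The \<open>j\<close>-th power only has terms \<open>w\<^sup>p\<close> with \<open>p \<ge> j\<close>.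
\<close>

primrec op_power :: "(nat \<Rightarrow> 'n::finite voa \<Rightarrow> 'n voa) \<Rightarrow> nat \<Rightarrow> nat \<Rightarrow> 'n voa \<Rightarrow> 'n voa" where
  "op_power X 0 p v = (if p = 0 then v else 0)"
| "op_power X (Suc j) p v = (\<Sum>n=1..p. X n (op_power X j (p - n) v))"

definition op_exp :: "(nat \<Rightarrow> 'n::finite voa \<Rightarrow> 'n voa) \<Rightarrow> nat \<Rightarrow> 'n voa \<Rightarrow> 'n voa" where
  "op_exp X p v = (\<Sum>j\<le>p. (1 / fact j) *\<^sub>p op_power X j p v)"

text \<open>\<open>exp(- \<Sum>\<^sub>n\<^sub><\<^sub>0 \<beta>(n)/n z\<^sup>-\<^sup>n)\<close>, \<open>exp(- \<Sum>\<^sub>n\<^sub>>\<^sub>0 \<beta>(n)/n z\<^sup>-\<^sup>n)\<close> and \<open>e\<^sup>\<beta>\<close>.\<close>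

definition exp_neg :: "int \<Rightarrow> 'n::finite latC \<Rightarrow> 'n distr" where
  "exp_neg k \<beta> s v =
    (if s \<ge> 0
     then op_exp (\<lambda>n w. (- (1 / (- of_nat n))) *\<^sub>p heis k (incl_C \<beta>) (- int n) w) (nat s) v
     else 0)"

definition exp_pos :: "int \<Rightarrow> 'n::finite latC \<Rightarrow> 'n distr" where
  "exp_pos k \<beta> s v =
    (if s \<le> 0
     then op_exp (\<lambda>n w. (- (1 / of_nat n)) *\<^sub>p heis k (incl_C \<beta>) (int n) w) (nat (- s)) v
     else 0)"

definition mult_gexp :: "'n::finite latC \<Rightarrow> 'n distr" where
  "mult_gexp \<beta> s v = (if s = 0 then gexp \<beta> * v else 0)"

definition Y_gexp :: "int \<Rightarrow> 'n::finite latC \<Rightarrow> 'n distr" where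
  "Y_gexp k \<beta> = dmult (exp_neg k \<beta>) (dmult (exp_pos k \<beta>) (mult_gexp \<beta>))"

text \<open>
  The parts of \<open>\<alpha>(z) = \<Sum>\<^sub>n \<alpha>(n) z\<^sup>-\<^sup>n\<^sup>-\<^sup>1\<close> with \<open>n < 0\<close> and with \<open>n \<ge> 0\<close>.
\<close>

definition heis_neg :: "int \<Rightarrow> 'n::finite cartan \<Rightarrow> 'n distr" where
  "heis_neg k \<alpha> s v = (if - s - 1 < 0 then heis k \<alpha> (- s - 1) v else 0)"

definition heis_nonneg :: "int \<Rightarrow> 'n::finite cartan \<Rightarrow> 'n distr" where
  "heis_nonneg k \<alpha> s v = (if - s - 1 \<ge> 0 then heis k \<alpha> (- s - 1) v else 0)"

text \<open>
  \<open>Y_list k [(\<alpha>\<^sub>1, m\<^sub>1), \<dots>, (\<alpha>\<^sub>s, m\<^sub>s)] \<beta>\<close> is the normally ordered product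
  \<open>: (\<partial>\<^bsub>m\<^sub>1\<^esub> \<alpha>\<^sub>1(z)) \<cdots> (\<partial>\<^bsub>m\<^sub>s\<^esub> \<alpha>\<^sub>s(z)) Y(e\<^sup>\<beta>, z) :\<close>.
\<close>

fun Y_list :: "int \<Rightarrow> ('n::finite cartan \<times> nat) list \<Rightarrow> 'n latC \<Rightarrow> 'n distr" where
  "Y_list k [] \<beta> = Y_gexp k \<beta>"
| "Y_list k ((\<alpha>, m) # xs) \<beta> = (\<lambda>s v.
     dmult (divided_deriv m (heis_neg k \<alpha>)) (Y_list k xs \<beta>) s v
     + dmult (Y_list k xs \<beta>) (divided_deriv m (heis_nonneg k \<alpha>)) s v)"

text \<open>
  The factors of a basis monomial are listed in an arbitrary order; the normally ordered product
  does not depend on it.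
\<close>

fun Y_basis :: "int \<Rightarrow> 'n::finite voa_basis \<Rightarrow> 'n distr" where
  "Y_basis k (M, \<beta>) = Y_list k (map (\<lambda>(b, m). (bvec b, m)) (SOME xs. mset xs = M)) \<beta>"

definition Y :: "int \<Rightarrow> 'n::finite voa \<Rightarrow> 'n distr" where
  "Y k u s v = lin_ext (\<lambda>x. Y_basis k x s v) u"

text \<open>The mode \<open>u\<^sub>n\<close>, defined by \<open>Y(u, z) = \<Sum>\<^sub>n u\<^sub>n z\<^sup>-\<^sup>n\<^sup>-\<^sup>1\<close>.\<close>

definition vmode :: "int \<Rightarrow> 'n::finite voa \<Rightarrow> int \<Rightarrow> 'n voa \<Rightarrow> 'n voa" where
  "vmode k u n = Y k u (- n - 1)"


section \<open>Algebras and quotients\<close>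

definition complex_ring :: "complex ring" where
  "complex_ring = \<lparr>carrier = UNIV, mult = (*), one = 1, zero = 0, add = (+)\<rparr>"

text \<open>
  The locale \<^locale>\<open>algebra\<close> of \<^theory>\<open>HOL-Algebra.Module\<close> is restricted to commutative
  algebras, hence a separate notion.
\<close>

locale assoc_algebra = module R A + ring A for R (structure) and A (structure) +
  assumes smult_mult_left:
      "\<lbrakk>a \<in> carrier R; x \<in> carrier A; y \<in> carrier A\<rbrakk>
        \<Longrightarrow> (a \<odot>\<^bsub>A\<^esub> x) \<otimes>\<^bsub>A\<^esub> y = a \<odot>\<^bsub>A\<^esub> (x \<otimes>\<^bsub>A\<^esub> y)"
    and smult_mult_right:
      "\<lbrakk>a \<in> carrier R; x \<in> carrier A; y \<in> carrier A\<rbrakk>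
        \<Longrightarrow> x \<otimes>\<^bsub>A\<^esub> (a \<odot>\<^bsub>A\<^esub> y) = a \<odot>\<^bsub>A\<^esub> (x \<otimes>\<^bsub>A\<^esub> y)"

definition assoc_algebra_iso ::
  "('r, 'm) ring_scheme \<Rightarrow> ('r, 'a) module \<Rightarrow> ('r, 'b) module \<Rightarrow> ('a \<Rightarrow> 'b) set"
  where "assoc_algebra_iso R A B =
    {h \<in> ring_iso A B. \<forall>a\<in>carrier R. \<forall>x\<in>carrier A. h (a \<odot>\<^bsub>A\<^esub> x) = a \<odot>\<^bsub>B\<^esub> h x}"

text \<open>
  Being isomorphic as associative algebras includes that both sides are associative algebras; for
  a quotient this means in particular that the induced product is well defined.
\<close>

definition assoc_algebras_isomorphic ::
  "('r, 'm) ring_scheme \<Rightarrow> ('r, 'a) module \<Rightarrow> ('r, 'b) module \<Rightarrow> bool"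
  where "assoc_algebras_isomorphic R A B \<longleftrightarrow>
    assoc_algebra R A \<and> assoc_algebra R B \<and> assoc_algebra_iso R A B \<noteq> {}"

text \<open>
  \<^const>\<open>FactRing\<close> with the induced scalar multiplication. It is also applied to products that are
  associative only modulo \<open>I\<close>.
\<close>

definition quot_algebra :: "('r, 'a) module \<Rightarrow> 'a set \<Rightarrow> ('r, 'a set) module" where
  "quot_algebra M I =
    ring.extend (M Quot I) (module.fields (\<lambda>a X. \<Union>x\<in>X. I +>\<^bsub>M\<^esub> (a \<odot>\<^bsub>M\<^esub> x)))"


section \<open>The Zhu algebra\<close>

fun weight :: "'n voa_basis \<Rightarrow> nat" where
  "weight (M, \<beta>) = (\<Sum>(b, m)\<in>#M. Suc m)"

definition hom_space :: "nat \<Rightarrow> 'n::finite voa set" where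
  "hom_space n = {u. \<forall>x\<in>Poly_Mapping.keys u. weight x = n}"

definition hom_comp :: "nat \<Rightarrow> 'n::finite voa \<Rightarrow> 'n voa" where
  "hom_comp n u = (\<Sum>x\<in>{x \<in> Poly_Mapping.keys u. weight x = n}. Poly_Mapping.single x (Poly_Mapping.lookup u x))"

text \<open>
  \<open>u \<circ> v\<close> and \<open>u * v\<close> for \<open>u\<close> homogeneous of weight \<open>n\<close>; the binomial coefficients vanish for
  \<open>i > n\<close>.
\<close>

definition zhu_circ :: "int \<Rightarrow> nat \<Rightarrow> 'n::finite voa \<Rightarrow> 'n voa \<Rightarrow> 'n voa" where
  "zhu_circ k n u v = (\<Sum>i\<le>n. of_nat (n choose i) *\<^sub>p vmode k u (int i - 2) v)"

definition zhu_star :: "int \<Rightarrow> nat \<Rightarrow> 'n::finite voa \<Rightarrow> 'n voa \<Rightarrow> 'n voa" where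
  "zhu_star k n u v = (\<Sum>i\<le>n. of_nat (n choose i) *\<^sub>p vmode k u (int i - 1) v)"

definition zhu_mult :: "int \<Rightarrow> 'n::finite voa \<Rightarrow> 'n voa \<Rightarrow> 'n voa" where
  "zhu_mult k u v = (\<Sum>n\<in>weight ` Poly_Mapping.keys u. zhu_star k n (hom_comp n u) v)"

definition zhu_O :: "int \<Rightarrow> 'n::finite voa set" where
  "zhu_O k = module.span pm_scale {zhu_circ k n u v | n u v. u \<in> hom_space n}"

definition zhu_pre :: "int \<Rightarrow> (complex, 'n::finite voa) module" where
  "zhu_pre k = \<lparr>carrier = UNIV, mult = zhu_mult k, one = gexp 0, zero = 0, add = (+),
                smult = pm_scale\<rparr>"

definition zhu_algebra :: "int \<Rightarrow> (complex, 'n::finite voa set) module" where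
  "zhu_algebra k = quot_algebra (zhu_pre k) (zhu_O k)"


section \<open>The algebra \<open>A\<close> given by generators and relations\<close>

datatype 'a free_monoid = Word "'a list"

instantiation free_monoid :: (type) monoid_add
begin

definition zero_free_monoid :: "'a free_monoid" where
  "0 = Word []"

fun plus_free_monoid :: "'a free_monoid \<Rightarrow> 'a free_monoid \<Rightarrow> 'a free_monoid" where
  "Word xs + Word ys = Word (xs @ ys)"

instance
proof
  fix x y z :: "'a free_monoid"
  show "x + y + z = x + (y + z)" by (cases x; cases y; cases z) simp
  show "0 + x = x" "x + 0 = x" by (cases x; simp add: zero_free_monoid_def)+
qed

end

text \<open>
  The monoid algebra of the free monoid, that is, the free unital associative algebra; its
  product is the one of \<^theory>\<open>HOL-Library.Poly_Mapping\<close>.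
\<close>

type_synonym 'a free_alg = "'a free_monoid \<Rightarrow>\<^sub>0 complex"

definition free_algebra :: "(complex, 'a free_alg) module" where
  "free_algebra = \<lparr>carrier = UNIV, mult = (*), one = 1, zero = 0, add = (+), smult = pm_scale\<rparr>"

definition free_gen :: "'a \<Rightarrow> 'a free_alg" where
  "free_gen g = Poly_Mapping.single (Word [g]) 1"

datatype 'n gen = GenE "'n latC" | GenD 'n

definition genE :: "'n::finite latC \<Rightarrow> 'n gen free_alg" where
  "genE \<alpha> = free_gen (GenE \<alpha>)"

definition genD :: "'n::finite \<Rightarrow> 'n gen free_alg" where
  "genD i = free_gen (GenD i)"

definition relations :: "int \<Rightarrow> 'n::finite gen free_alg set" where
  "relations k =
     {genE 0 - 1}
   \<union> {genE (\<alpha> + \<beta>) - genE \<alpha> * genE \<beta> | \<alpha> \<beta>. True}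
   \<union> {genD i * genE \<alpha> - genE \<alpha> * genD i - form k (bvec (Inr i)) (incl_C \<alpha>) *\<^sub>p genE \<alpha> | i \<alpha>. True}
   \<union> {genD i * genD j - genD j * genD i | i j. True}"

definition algebra_A :: "int \<Rightarrow> (complex, 'n::finite gen free_alg set) module" where
  "algebra_A k = quot_algebra free_algebra (Idl\<^bsub>free_algebra\<^esub> (relations k))"

end

theory Submission
  imports Defs
begin

text \<open>
  For \<open>u\<close> homogeneous the zero mode \<open>u\<^bsub>wt u - 1\<^esub>\<close> preserves the top level \<open>V\<^sub>0 = \<complex>[L\<^sub>C]\<close> of \<open>V\<close>. On \<open>V\<^sub>0\<close>
  only the modes \<open>\<alpha>(0)\<close> survive, so this operator is explicit on monomials: every \<open>d\<^sub>i(-n)\<close> acts as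
  \<open>(-1)\<^bsup>n-1\<^esup> d\<^sub>i(0)\<close>, and every \<open>c\<^sub>i(-n)\<close> acts as zero. Since \<open>\<partial>\<^sub>m (1 / (1 + z))\<close> is a multiple of
  \<open>(1 + z)\<^bsup>-m-1\<^esup>\<close>, the action of \<open>(1 + z)\<^bsup>wt u\<^esup> Y(u, z) v\<close> on \<open>V\<^sub>0\<close> is a polynomial in \<open>1 / z\<close> whose constant
  term is the product of the actions of \<open>u\<close> and \<open>v\<close>. Hence \<open>V \<rightarrow> End(V\<^sub>0)\<close> is multiplicative for \<open>*\<close>
  and kills all \<open>u \<circ> v\<close>; no Jacobi identity is needed.

  Modulo \<open>O(V)\<close> the space \<open>V\<close> is spanned by the monomials in the \<open>d\<^sub>i(-1)\<close> times some \<open>e\<^sup>\<alpha>\<close>, and the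
  algebra \<open>A\<close> is spanned by the words \<open>e\<^sub>\<alpha> d\<^bsub>i\<^sub>1\<^esub> \<cdots> d\<^bsub>i\<^sub>r\<^esub>\<close>. Both families have the same images in \<open>End(V\<^sub>0)\<close>,
  which are linearly independent because monomials are pairwise distinct characters of the
  multiplicative monoid \<open>\<int>\<^sup>\<nu>\<close>. So \<open>A(V)\<close> and \<open>A\<close> are isomorphic to the same subalgebra of \<open>End(V\<^sub>0)\<close>.
\<close>

section \<open>Linear maps on finitely supported functions\<close>

interpretation pm: vector_space pm_scale
  by (rule vector_space_pm_scale)

abbreviation pm_linear :: "(('a \<Rightarrow>\<^sub>0 complex) \<Rightarrow> ('b \<Rightarrow>\<^sub>0 complex)) \<Rightarrow> bool" where
  "pm_linear \<equiv> Vector_Spaces.linear pm_scale pm_scale"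

lemma pm_linearI:
  assumes "\<And>u v. f (u + v) = f u + f v" "\<And>a u. f (a *\<^sub>p u) = a *\<^sub>p f u"
  shows "pm_linear f"
  using assms
  by (simp add: Vector_Spaces.linear_def module_hom_def module_hom_axioms_def pm.module_axioms vector_space_pm_scale)

lemma
  assumes "pm_linear f"
  shows pm_linear_add: "f (u + v) = f u + f v"
    and pm_linear_scale: "f (a *\<^sub>p u) = a *\<^sub>p f u"
    and pm_linear_0: "f 0 = 0"
    and pm_linear_diff: "f (u - v) = f u - f v"
    and pm_linear_sum: "f (sum g S) = (\<Sum>x\<in>S. f (g x))"
proof -
  interpret Vector_Spaces.linear pm_scale pm_scale f by fact
  show "f (u + v) = f u + f v" "f (a *\<^sub>p u) = a *\<^sub>p f u" "f 0 = 0" "f (u - v) = f u - f v"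
      "f (sum g S) = (\<Sum>x\<in>S. f (g x))"
    by (auto simp: add scale zero diff sum)
qed

lemma pm_scale_single [simp]: "a *\<^sub>p Poly_Mapping.single x b = Poly_Mapping.single x (a * b)"
  by (rule poly_mapping_eqI) (simp add: lookup_single when_def)

lemma pm_scale_eq_mult: "a *\<^sub>p f = Poly_Mapping.single 0 a * f"
  for f :: "'a::monoid_add \<Rightarrow>\<^sub>0 complex"
  by (simp add: pm_scale_def mult_map_scale_conv_mult)

lemma poly_mapping_sum_singles:
  "(\<Sum>x\<in>Poly_Mapping.keys u. Poly_Mapping.single x (Poly_Mapping.lookup u x)) = u"
  by (rule poly_mapping_eqI) (auto simp: lookup_sum lookup_single when_def sum.delta' in_keys_iff)

lemma lin_ext_superset:
  assumes "finite S" "Poly_Mapping.keys u \<subseteq> S"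
  shows "lin_ext f u = (\<Sum>x\<in>S. Poly_Mapping.lookup u x *\<^sub>p f x)"
  unfolding lin_ext_def using assms
  by (intro sum.mono_neutral_left) (auto simp: in_keys_iff)

lemma lin_ext_linear: "pm_linear (lin_ext f)"
proof (rule pm_linearI)
  fix u v :: "'a \<Rightarrow>\<^sub>0 complex" and a
  let ?S = "Poly_Mapping.keys u \<union> Poly_Mapping.keys v"
  show "lin_ext f (u + v) = lin_ext f u + lin_ext f v"
    using Poly_Mapping.keys_add[of u v]
    by (simp add: lin_ext_superset[where S = ?S] lookup_add pm.scale_left_distrib sum.distrib)
  have "Poly_Mapping.keys (a *\<^sub>p u) \<subseteq> Poly_Mapping.keys u" by (auto simp: in_keys_iff)
  then have "lin_ext f (a *\<^sub>p u)
      = (\<Sum>x\<in>Poly_Mapping.keys u. Poly_Mapping.lookup (a *\<^sub>p u) x *\<^sub>p f x)"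
    by (intro lin_ext_superset) auto
  then show "lin_ext f (a *\<^sub>p u) = a *\<^sub>p lin_ext f u"
    by (simp add: lin_ext_def pm.scale_sum_right)
qed

lemmas lin_ext_add = pm_linear_add[OF lin_ext_linear]
  and lin_ext_scale = pm_linear_scale[OF lin_ext_linear]
  and lin_ext_0 [simp] = pm_linear_0[OF lin_ext_linear]

lemma lin_ext_single [simp]: "lin_ext f (Poly_Mapping.single x a) = a *\<^sub>p f x"
  by (simp add: lin_ext_def)

lemma poly_mapping_in_subspace:
  assumes "pm.subspace S" "\<And>x. x \<in> Poly_Mapping.keys u \<Longrightarrow> Poly_Mapping.single x 1 \<in> S"
  shows "u \<in> S"
proof -
  have "(\<Sum>x\<in>Poly_Mapping.keys u. Poly_Mapping.lookup u x *\<^sub>p Poly_Mapping.single x 1) \<in> S"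
    using assms by (intro pm.subspace_sum pm.subspace_scale)
  then show ?thesis by (simp add: poly_mapping_sum_singles)
qed

lemma lin_ext_in_subspace:
  assumes "pm.subspace S" "\<And>x. x \<in> Poly_Mapping.keys u \<Longrightarrow> f x \<in> S"
  shows "lin_ext f u \<in> S"
  unfolding lin_ext_def by (rule pm.subspace_sum[OF assms(1)], rule pm.subspace_scale[OF assms(1)], rule assms(2))

lemma pm_linear_eqI:
  assumes "pm_linear f" "pm_linear g"
    and "\<And>x. f (Poly_Mapping.single x 1) = g (Poly_Mapping.single x 1)"
  shows "f u = g u"
proof -
  have "pm.subspace {u. f u = g u}"
    unfolding pm.subspace_def
    using pm_linear_add[OF assms(1)] pm_linear_scale[OF assms(1)] pm_linear_0[OF assms(1)]
      pm_linear_add[OF assms(2)] pm_linear_scale[OF assms(2)] pm_linear_0[OF assms(2)] by auto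
  then have "u \<in> {u. f u = g u}"
    by (rule poly_mapping_in_subspace) (simp add: assms(3))
  then show ?thesis by simp
qed

lemma pm_linear_comp: "pm_linear f \<Longrightarrow> pm_linear g \<Longrightarrow> pm_linear (\<lambda>u. f (g u))"
  by (intro pm_linearI) (auto simp: pm_linear_add pm_linear_scale)

lemma pm_linear_plus: "pm_linear f \<Longrightarrow> pm_linear g \<Longrightarrow> pm_linear (\<lambda>u. f u + g u)"
  by (intro pm_linearI) (auto simp: pm_linear_add pm_linear_scale pm.scale_right_distrib)

lemma pm_linear_cmul: "pm_linear f \<Longrightarrow> pm_linear (\<lambda>u. a *\<^sub>p f u)"
  by (intro pm_linearI) (auto simp: pm_linear_add pm_linear_scale pm.scale_right_distrib ac_simps)

lemma pm_linear_id: "pm_linear (\<lambda>u. u)"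
  by (intro pm_linearI) auto

lemma pm_scale_mult_left: "(a *\<^sub>p u) * v = a *\<^sub>p (u * v)"
  for u v :: "'a::monoid_add \<Rightarrow>\<^sub>0 complex"
  by (simp add: pm_scale_eq_mult mult.assoc)

text \<open>The exponents may form a noncommutative monoid, as they do for words, so the scalar is
  moved past \<open>u\<close> on singletons.\<close>

lemma pm_scale_mult_right: "u * (a *\<^sub>p v) = a *\<^sub>p (u * v)"
  for u v :: "'a::monoid_add \<Rightarrow>\<^sub>0 complex"
proof -
  let ?s = "\<lambda>u x. Poly_Mapping.single x (Poly_Mapping.lookup u x)"
  have "sum (?s u) (Poly_Mapping.keys u) * (a *\<^sub>p sum (?s v) (Poly_Mapping.keys v))
      = a *\<^sub>p (sum (?s u) (Poly_Mapping.keys u) * sum (?s v) (Poly_Mapping.keys v))"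
    by (simp add: pm.scale_sum_right sum_product mult_single mult.left_commute)
  then show ?thesis by (simp only: poly_mapping_sum_singles)
qed

lemma pm_linear_mult_left: "pm_linear (\<lambda>u. a * u)"
  for a :: "'a::monoid_add \<Rightarrow>\<^sub>0 complex"
  by (intro pm_linearI) (auto simp: pm_scale_mult_right distrib_left)

lemma pm_linear_mult_right: "pm_linear (\<lambda>u. u * a)"
  for a :: "'a::monoid_add \<Rightarrow>\<^sub>0 complex"
  by (intro pm_linearI) (auto simp: pm_scale_mult_left distrib_right)

lemma pm_linear_lin_ext_arg:
  assumes "pm_linear h" shows "h (lin_ext f u) = lin_ext (\<lambda>x. h (f x)) u"
  by (simp add: lin_ext_def pm_linear_sum[OF assms] pm_linear_scale[OF assms])

lemma lin_ext_lin_ext: "lin_ext f (lin_ext g u) = lin_ext (\<lambda>x. lin_ext f (g x)) u"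
  by (rule pm_linear_lin_ext_arg[OF lin_ext_linear])

lemma lin_ext_fun_add: "lin_ext (\<lambda>x. f x + g x) u = lin_ext f u + lin_ext g u"
  by (simp add: lin_ext_def sum.distrib pm.scale_right_distrib)

lemma lin_ext_fun_scale: "lin_ext (\<lambda>x. a *\<^sub>p f x) u = a *\<^sub>p lin_ext f u"
  by (simp add: pm_linear_lin_ext_arg[OF pm_linear_cmul[OF pm_linear_id]])

lemma lin_ext_fun_0 [simp]: "lin_ext (\<lambda>x. 0) u = 0"
  by (simp add: lin_ext_def)

lemma lin_ext_singles [simp]: "lin_ext (\<lambda>x. Poly_Mapping.single x 1) u = u"
  by (simp add: lin_ext_def poly_mapping_sum_singles)

lemma pm_linear_Sum_any:
  assumes "pm_linear f" "finite {p. g p \<noteq> 0}"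
  shows "f (Sum_any g) = Sum_any (\<lambda>p. f (g p))"
proof -
  have "{p. f (g p) \<noteq> 0} \<subseteq> {p. g p \<noteq> 0}" using pm_linear_0[OF assms(1)] by auto
  then show ?thesis
    using assms by (simp add: Sum_any.expand_superset[of "{p. g p \<noteq> 0}"] pm_linear_sum)
qed

lemma Sum_any_in_subspace:
  assumes "pm.subspace S" "\<And>p. f p \<in> S"
  shows "Sum_any f \<in> S"
  using assms by (simp add: Sum_any.expand_set pm.subspace_sum)

lemma Sum_any_only:
  assumes "\<And>p. p \<noteq> q \<Longrightarrow> f p = 0"
  shows "Sum_any f = f q"
  using Sum_any.expand_superset[of "{q}" f] assms by auto


section \<open>Multiplication by \<open>1 + z\<close> on coefficient sequences\<close>

definition mul1z :: "(int \<Rightarrow> ('b \<Rightarrow>\<^sub>0 complex)) \<Rightarrow> int \<Rightarrow> ('b \<Rightarrow>\<^sub>0 complex)" where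
  "mul1z y s = y s + y (s - 1)"

text \<open>It turns both Zhu products into coefficients: for \<open>u\<close> homogeneous of weight
  \<open>n\<close>, u \<circ> v is the coefficient of z and the star product that of 1 in (1 + z)^n
  Y(u, z) v.\<close>

lemma mul1z_funpow:
  "(mul1z ^^ n) y s = (\<Sum>i\<le>n. of_nat (n choose i) *\<^sub>p y (s - int i))"
proof (induction n arbitrary: s)
  case (Suc n)
  let ?c = "\<lambda>n i. of_nat (n choose i) :: complex"
  have "(\<Sum>i\<le>Suc n. ?c (Suc n) i *\<^sub>p y (s - int i))
      = y s + (\<Sum>i\<le>n. ?c (Suc n) (Suc i) *\<^sub>p y (s - int (Suc i)))"
    by (subst sum.atMost_Suc_shift) simp
  also have "\<dots> = (y s + (\<Sum>i\<le>n. ?c n (Suc i) *\<^sub>p y (s - int (Suc i))))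
      + (\<Sum>i\<le>n. ?c n i *\<^sub>p y (s - 1 - int i))"
    by (simp add: pm.scale_left_distrib sum.distrib algebra_simps)
  also have "y s + (\<Sum>i\<le>n. ?c n (Suc i) *\<^sub>p y (s - int (Suc i)))
      = (\<Sum>i\<le>Suc n. ?c n i *\<^sub>p y (s - int i))"
    by (subst sum.atMost_Suc_shift) simp
  also have "\<dots> = (\<Sum>i\<le>n. ?c n i *\<^sub>p y (s - int i))"
    by simp
  finally show ?case by (simp add: mul1z_def[of _ s] Suc.IH)
qed simp

lemma mul1z_funpow_scale: "(mul1z ^^ n) (\<lambda>s. a *\<^sub>p y s) s = a *\<^sub>p (mul1z ^^ n) y s"
  by (simp add: mul1z_funpow pm.scale_sum_right mult.commute)

lemma mul1z_funpow_add:
  "(mul1z ^^ n) (\<lambda>s. y s + y' s) s = (mul1z ^^ n) y s + (mul1z ^^ n) y' s"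
  by (simp add: mul1z_funpow pm.scale_right_distrib sum.distrib)

lemma mul1z_funpow_sum:
  "(mul1z ^^ n) (\<lambda>s. \<Sum>t\<in>S. y t s) s = (\<Sum>t\<in>S. (mul1z ^^ n) (y t) s)"
  by (simp add: mul1z_funpow pm.scale_sum_right sum.swap[of _ S])

lemma mul1z_funpow_shift: "(mul1z ^^ n) (\<lambda>s. y (s - t)) s = (mul1z ^^ n) y (s - t)"
  by (simp add: mul1z_funpow algebra_simps)

text \<open>For a series without positive powers of z, multiplication by (1 + z)^n raises the top
  degree by \<open>n\<close> and keeps the leading coefficient.\<close>

lemma mul1z_funpow_above:
  assumes "\<And>s. s > 0 \<Longrightarrow> y s = 0"
  shows "s > int n \<Longrightarrow> (mul1z ^^ n) y s = 0" and "(mul1z ^^ n) y (int n) = y 0"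
proof -
  have "(mul1z ^^ n) y s = 0 \<and> (mul1z ^^ n) y (int n) = y 0" if "s > int n" for s
    using that
  proof (induction n arbitrary: s)
    case (Suc n)
    from Suc.IH[of s] Suc.IH[of "s - 1"] Suc.IH[of "int n + 1"] Suc.prems
    show ?case by (simp add: mul1z_def add.commute)
  qed (auto simp: assms)
  from this[of s] this[of "int n + 1"]
  show "s > int n \<Longrightarrow> (mul1z ^^ n) y s = 0" "(mul1z ^^ n) y (int n) = y 0" by auto
qed

text \<open>The coefficients of the \<open>m\<close>-th divided derivative of \<open>1 / (1 + z)\<close>.\<close>

definition neg_coeff :: "nat \<Rightarrow> int \<Rightarrow> complex" where
  "neg_coeff m p = (if p + int m \<ge> 0
     then (- 1) ^ nat (p + int m) * of_nat (nat (p + int m) choose m) else 0)"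

lemma neg_coeff_0: "neg_coeff 0 p + neg_coeff 0 (p - 1) = (if p = 0 then 1 else 0)"
proof -
  consider "p < 0" | "p = 0" | "p > 0" by linarith
  then show ?thesis 
  proof cases
    case 3
    then have "nat p = Suc (nat (p - 1))" by simp
    with 3 show ?thesis by (simp add: neg_coeff_def)
  qed (auto simp: neg_coeff_def)
qed

text \<open>The m-th divided derivative of 1 / (1 + z) is (-1)^m (1 + z)^(-m-1), so a factor 1 + z
  lowers m by one and changes the sign; on coefficients this is Pascal's rule.\<close>

lemma neg_coeff_Suc: "neg_coeff (Suc m) p + neg_coeff (Suc m) (p - 1) = - neg_coeff m p"
proof (cases "p + int m \<ge> 0")
  case True
  then obtain q where q: "p + int m = int q" by (metis nonneg_int_cases)
  then have "nat (p + int (Suc m)) = Suc q" "nat (p - 1 + int (Suc m)) = q" "nat (p + int m) = q" by auto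
  with q show ?thesis by (simp add: neg_coeff_def algebra_simps)
next
  case False
  then show ?thesis by (cases "p + int m = -1") (auto simp: neg_coeff_def)
qed

lemma neg_coeff_below: "p < 0 \<Longrightarrow> neg_coeff m p = 0"
  by (auto simp: neg_coeff_def binomial_eq_0)

text \<open>\<open>Sum_any\<close> is 0 on infinite supports, so convolutions may be rearranged only
  after such a check. Here \<open>neg_coeff\<close> bounds p from below and the truncation of
  \<open>y\<close> bounds it from above.\<close>

lemma finite_conv_support:
  assumes "\<And>s. s < N \<Longrightarrow> y s = 0"
  shows "finite {p. neg_coeff m p *\<^sub>p y (s - p) \<noteq> 0}"
proof (rule finite_subset)
  show "{p. neg_coeff m p *\<^sub>p y (s - p) \<noteq> 0} \<subseteq> {0..s - N}"
  proof
    fix p assume p: "p \<in> {p. neg_coeff m p *\<^sub>p y (s - p) \<noteq> 0}"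
    then have "neg_coeff m p \<noteq> 0" "y (s - p) \<noteq> 0" by auto
    then show "p \<in> {0..s - N}" using neg_coeff_below[of p m] assms[of "s - p"] by force
  qed
qed simp

lemma mul1z_conv:
  assumes y: "\<And>s. s < N \<Longrightarrow> y s = 0"
  shows "mul1z (\<lambda>s. Sum_any (\<lambda>p. neg_coeff m p *\<^sub>p y (s - p))) s
       = Sum_any (\<lambda>p. (neg_coeff m p + neg_coeff m (p - 1)) *\<^sub>p y (s - p))"
proof -
  have bij: "bij (\<lambda>p::int. p - 1)"
    by (rule bij_betwI[of _ _ _ "\<lambda>p. p + 1"]) auto
  have re: "Sum_any (\<lambda>p. neg_coeff m p *\<^sub>p y (s - 1 - p)) = Sum_any (\<lambda>p. neg_coeff m (p - 1) *\<^sub>p y (s - p))"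
    by (rule Sum_any.reindex_cong[OF bij]) auto
  have "{p. neg_coeff m (p - 1) *\<^sub>p y (s - p) \<noteq> 0} = (\<lambda>p. p + 1) ` {p. neg_coeff m p *\<^sub>p y (s - 1 - p) \<noteq> 0}"
    by (auto simp: image_iff algebra_simps intro!: exI[of _ "_ - 1"])
  then have "finite {p. neg_coeff m (p - 1) *\<^sub>p y (s - p) \<noteq> 0}"
    using finite_conv_support[of N y m "s - 1"] y by simp
  then show ?thesis
    unfolding mul1z_def re pm.scale_left_distrib
    by (intro Sum_any.distrib[symmetric] finite_conv_support[OF y])
qed

text \<open>The factor (1 + z)^(m+1) cancels the pole of the m-th divided derivative of 1 / (1 + z)
  and leaves its sign. One factor reduces m + 1 to m by \<open>neg_coeff_Suc\<close>.\<close>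

lemma mul1z_funpow_conv:
  assumes y: "\<And>s. s < N \<Longrightarrow> y s = 0"
  shows "(mul1z ^^ Suc m) (\<lambda>s. Sum_any (\<lambda>p. neg_coeff m p *\<^sub>p y (s - p))) = (\<lambda>s. (- 1) ^ m *\<^sub>p y s)"
proof (induction m)
  case 0
  have "Sum_any (\<lambda>p. (if p = 0 then 1 else 0) *\<^sub>p y (s - p)) = y s" for s
    by (subst Sum_any_only[of 0]) auto
  moreover have "mul1z (\<lambda>s. Sum_any (\<lambda>p. neg_coeff 0 p *\<^sub>p y (s - p))) s
      = Sum_any (\<lambda>p. (neg_coeff 0 p + neg_coeff 0 (p - 1)) *\<^sub>p y (s - p))" for s
    by (rule mul1z_conv[OF y])
  ultimately show ?case by (simp add: fun_eq_iff neg_coeff_0)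
next
  case (Suc m)
  have "mul1z (\<lambda>s. Sum_any (\<lambda>p. neg_coeff (Suc m) p *\<^sub>p y (s - p))) s
      = Sum_any (\<lambda>p. (neg_coeff (Suc m) p + neg_coeff (Suc m) (p - 1)) *\<^sub>p y (s - p))" for s
    by (rule mul1z_conv[OF y])
  then have "mul1z (\<lambda>s. Sum_any (\<lambda>p. neg_coeff (Suc m) p *\<^sub>p y (s - p)))
      = (\<lambda>s. Sum_any (\<lambda>p. (-1) *\<^sub>p neg_coeff m p *\<^sub>p y (s - p)))"
    by (simp add: fun_eq_iff neg_coeff_Suc)
  also have "\<dots> = (\<lambda>s. (-1) *\<^sub>p Sum_any (\<lambda>p. neg_coeff m p *\<^sub>p y (s - p)))"
    using pm_linear_Sum_any[OF pm_linear_cmul[OF pm_linear_id] finite_conv_support[of N y m], of "- 1"] y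
    by simp
  finally have eq: "mul1z (\<lambda>s. Sum_any (\<lambda>p. neg_coeff (Suc m) p *\<^sub>p y (s - p)))
      = (\<lambda>s. (-1) *\<^sub>p Sum_any (\<lambda>p. neg_coeff m p *\<^sub>p y (s - p)))" .
  show ?case
  proof
    fix s
    show "(mul1z ^^ Suc (Suc m)) (\<lambda>s. Sum_any (\<lambda>p. neg_coeff (Suc m) p *\<^sub>p y (s - p))) s
        = (- 1) ^ Suc m *\<^sub>p y s"
      unfolding funpow_Suc_right[of "Suc m"] o_apply eq mul1z_funpow_scale Suc.IH by simp
  qed
qed

section \<open>The Heisenberg action and filtrations\<close>

text \<open>Every filtration below has the form \<open>supp S\<close> for a set of basis monomials,
  so that an operator can be bounded monomial by monomial.\<close>

definition supp :: "'a set \<Rightarrow> ('a \<Rightarrow>\<^sub>0 complex) set" where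
  "supp S = {v. Poly_Mapping.keys v \<subseteq> S}"

lemma subspace_supp: "pm.subspace (supp S)"
proof -
  have "Poly_Mapping.keys (a *\<^sub>p v) \<subseteq> Poly_Mapping.keys v" for a and v :: "'a \<Rightarrow>\<^sub>0 complex"
    by (auto simp: in_keys_iff)
  then show ?thesis
    unfolding pm.subspace_def supp_def
    by (auto dest!: subsetD[OF Poly_Mapping.keys_add])
qed

lemma zero_in_supp [simp]: "0 \<in> supp S"
  by (simp add: supp_def)

lemma single_in_supp [simp]: "Poly_Mapping.single x a \<in> supp S \<longleftrightarrow> a = 0 \<or> x \<in> S"
  by (simp add: supp_def)

lemma supp_mono: "S \<subseteq> T \<Longrightarrow> v \<in> supp S \<Longrightarrow> v \<in> supp T"
  by (auto simp: supp_def)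

lemma supp_empty: "v \<in> supp {} \<Longrightarrow> v = 0"
  by (simp add: supp_def)

lemma lin_ext_supp:
  assumes "\<And>x. x \<in> S \<Longrightarrow> f x \<in> supp T" "v \<in> supp S"
  shows "lin_ext f v \<in> supp T"
  using assms by (intro lin_ext_in_subspace subspace_supp) (auto simp: supp_def)

section \<open>Heisenberg modes and the weight filtration\<close>

lemma heis_linear: "pm_linear (heis k a n)"
  by (simp add: heis_def[abs_def] lin_ext_linear)

lemma heis_0 [simp]: "heis k a n 0 = 0"
  by (simp add: heis_def)

text \<open>The bound is an integer because vanishing is proved by pushing it below 0.\<close>

definition wt_le :: "int \<Rightarrow> 'n::finite voa set" where
  "wt_le t = supp {x. int (weight x) \<le> t}"

lemma subspace_wt_le: "pm.subspace (wt_le t)"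
  by (simp add: wt_le_def subspace_supp)

lemma wt_le_neg:
  assumes "v \<in> wt_le t" "t < 0" shows "v = 0"
proof -
  have "{x. int (weight x) \<le> t} = {}"
    using assms(2) by (metis (mono_tags, lifting) empty_Collect_eq le_less_trans not_less of_nat_0_le_iff)
  then show ?thesis using assms by (auto simp: wt_le_def intro: supp_empty)
qed

lemma ex_wt_le: "\<exists>t. v \<in> wt_le t"
proof
  show "v \<in> wt_le (\<Sum>x\<in>Poly_Mapping.keys v. int (weight x))"
    unfolding wt_le_def supp_def
    by (clarify, rule member_le_sum[where f = "\<lambda>x. int (weight x)"]) auto
qed

lemma weight_remove:
  "x \<in># M \<Longrightarrow> int (weight (M - {#x#}, \<beta>)) = int (weight (M, \<beta>)) - int (snd x) - 1"
  by (auto dest!: multi_member_split split: prod.splits)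

lemma heis_basis_wt_le:
  assumes "int (weight x) \<le> t"
  shows "heis_basis k a n x \<in> wt_le (t - n)"
proof (cases x)
  case (Pair M \<beta>)
  have "Poly_Mapping.single (M - {#(b, nat n - 1)#}, \<beta>)
      (of_int n * form k a (bvec b) * of_nat (count M (b, nat n - 1))) \<in> wt_le (t - n)" if "n > 0" for b
  \<comment> \<open>For an absent variable the multiset difference does not lower the weight, but
    then the factor \<open>count\<close> makes the term vanish.\<close>
  proof (cases "(b, nat n - 1) \<in># M")
    case True
    then show ?thesis using weight_remove[OF True, of \<beta>] that assms Pair by (simp add: wt_le_def)
  qed (simp add: not_in_iff wt_le_def)
  then show ?thesis
    using assms Pair by (auto simp: wt_le_def intro!: pm.subspace_sum subspace_supp)
qed

lemma heis_wt_le: "v \<in> wt_le t \<Longrightarrow> heis k a n v \<in> wt_le (t - n)"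
  unfolding heis_def wt_le_def
  by (erule lin_ext_supp[rotated]) (simp add: heis_basis_wt_le flip: wt_le_def)

text \<open>The slope \<open>d\<close> is 1 for creation and -1 for annihilation operators in the
  weight filtration, and 0 in the filtration by the number of d-variables.\<close>

lemma op_power_in_subspace:
  assumes W: "\<And>t. pm.subspace (W t)"
    and X: "\<And>n t v. n \<ge> 1 \<Longrightarrow> v \<in> W t \<Longrightarrow> X n v \<in> W (t + d * int n)"
    and v: "v \<in> W t"
  shows "op_power X j p v \<in> W (t + d * int p)"
proof (induction j arbitrary: p)
  case 0
  show ?case using v pm.subspace_0[OF W] by auto
next
  case (Suc j)
  have "X n (op_power X j (p - n) v) \<in> W (t + d * int p)" if "n \<in> {1..p}" for n
    using X[OF _ Suc.IH, of n "p - n"] that by (simp add: algebra_simps)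
  then show ?case by (auto intro!: pm.subspace_sum[OF W])
qed

lemma op_exp_in_subspace:
  assumes W: "\<And>t. pm.subspace (W t)"
    and X: "\<And>n t v. n \<ge> 1 \<Longrightarrow> v \<in> W t \<Longrightarrow> X n v \<in> W (t + d * int n)"
    and v: "v \<in> W t"
  shows "op_exp X p v \<in> W (t + d * int p)"
  unfolding op_exp_def
  by (intro pm.subspace_sum[OF W] pm.subspace_scale[OF W] op_power_in_subspace[of W X d, OF assms])

lemma op_power_zero_arg: "(\<And>n. X n 0 = 0) \<Longrightarrow> op_power X j p 0 = 0"
  by (induction j arbitrary: p) auto

lemma op_exp_zero_arg: "(\<And>n. X n 0 = 0) \<Longrightarrow> op_exp X p 0 = 0"
  by (simp add: op_exp_def op_power_zero_arg)

lemma op_exp_0: "op_exp X 0 v = v"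
  by (simp add: op_exp_def)

text \<open>The number \<open>d\<close> plays the role of the conformal weight of a field; it is
  additive under products, and for \<open>Y_list\<close> it is the weight of the monomial.\<close>

definition raises :: "'n::finite distr \<Rightarrow> int \<Rightarrow> bool" where
  "raises F d \<longleftrightarrow> (\<forall>s t v. v \<in> wt_le t \<longrightarrow> F s v \<in> wt_le (t + s + d))"

lemma raises_dmult:
  assumes "raises F d" "raises G e"
  shows "raises (dmult F G) (d + e)"
  unfolding raises_def dmult_def
proof (intro allI impI Sum_any_in_subspace subspace_wt_le)
  fix s t p and v :: "'a voa" assume "v \<in> wt_le t"
  then have "F p (G (s - p) v) \<in> wt_le (t + (s - p) + e + p + d)"
    using assms unfolding raises_def by blast
  then show "F p (G (s - p) v) \<in> wt_le (t + s + (d + e))" by (simp add: algebra_simps)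
qed

lemma dderiv_funpow: "(dderiv ^^ m) F s v = pochhammer (of_int s + 1) m *\<^sub>p F (s + int m) v"
proof (induction m arbitrary: s)
  case (Suc m)
  show ?case by (simp add: dderiv_def[of _ s] Suc.IH pochhammer_rec algebra_simps)
qed simp

text \<open>The generalized binomial coefficient is required because \<open>s + int m\<close> is
  negative for the annihilation modes.\<close>

lemma divided_deriv_eq:
  "divided_deriv m F s v = (of_int (s + int m) gchoose m) *\<^sub>p F (s + int m) v"
  by (simp add: divided_deriv_def dderiv_funpow gbinomial_pochhammer' field_simps)

lemma raises_heis_neg: "raises (divided_deriv m (heis_neg k a)) (int m + 1)"
  unfolding raises_def divided_deriv_eq heis_neg_def
proof (intro allI impI)
  fix s t and v :: "'a voa" assume "v \<in> wt_le t"
  from heis_wt_le[OF this, of k a "- (s + int m) - 1"]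
  show "((of_int (s + int m) gchoose m) *\<^sub>p (if - (s + int m) - 1 < 0 then heis k a (- (s + int m) - 1) v else 0))
     \<in> wt_le (t + s + (int m + 1))"
    by (intro pm.subspace_scale[OF subspace_wt_le]) (auto simp: algebra_simps pm.subspace_0[OF subspace_wt_le])
qed

lemma raises_heis_nonneg: "raises (divided_deriv m (heis_nonneg k a)) (int m + 1)"
  unfolding raises_def divided_deriv_eq heis_nonneg_def
proof (intro allI impI)
  fix s t and v :: "'a voa" assume "v \<in> wt_le t"
  from heis_wt_le[OF this, of k a "- (s + int m) - 1"]
  show "((of_int (s + int m) gchoose m) *\<^sub>p (if - (s + int m) - 1 \<ge> 0 then heis k a (- (s + int m) - 1) v else 0))
     \<in> wt_le (t + s + (int m + 1))"
    by (intro pm.subspace_scale[OF subspace_wt_le]) (auto simp: algebra_simps pm.subspace_0[OF subspace_wt_le])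
qed

lemma raises_exp_neg: "raises (exp_neg k \<beta>) 0"
  unfolding raises_def
proof (intro allI impI)
  fix s t and v :: "'a voa" assume v: "v \<in> wt_le t"
  have "op_exp (\<lambda>n w. c n *\<^sub>p heis k a (- int n) w) p v \<in> wt_le (t + 1 * int p)" for p a c
    using heis_wt_le[where n = "- int _"]
    by (intro op_exp_in_subspace[where W = wt_le, OF subspace_wt_le _ v] pm.subspace_scale[OF subspace_wt_le])
      fastforce
  from this[of _ _ "nat s"] show "exp_neg k \<beta> s v \<in> wt_le (t + s + 0)"
    by (auto simp: exp_neg_def pm.subspace_0[OF subspace_wt_le])
qed

lemma raises_exp_pos: "raises (exp_pos k \<beta>) 0"
  unfolding raises_def
proof (intro allI impI)
  fix s t and v :: "'a voa" assume v: "v \<in> wt_le t"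
  have "op_exp (\<lambda>n w. c n *\<^sub>p heis k a (int n) w) p v \<in> wt_le (t + - 1 * int p)" for p a c
    using heis_wt_le[where n = "int _"]
    by (intro op_exp_in_subspace[where W = wt_le, OF subspace_wt_le _ v] pm.subspace_scale[OF subspace_wt_le])
      fastforce
  from this[of _ _ "nat (- s)"] show "exp_pos k \<beta> s v \<in> wt_le (t + s + 0)"
    by (auto simp: exp_pos_def pm.subspace_0[OF subspace_wt_le] simp del: pm.scale_minus_left)
qed

lemma gexp_times: "gexp \<alpha> * v = lin_ext (\<lambda>(M, \<beta>). Poly_Mapping.single (M, \<alpha> + \<beta>) 1) v"
  by (rule pm_linear_eqI[OF pm_linear_mult_left lin_ext_linear])
    (auto simp: gexp_def mult_single split: prod.splits)

lemma gexp_times_wt_le: "v \<in> wt_le t \<Longrightarrow> gexp \<alpha> * v \<in> wt_le t"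
  unfolding gexp_times wt_le_def by (rule lin_ext_supp) auto

section \<open>Finiteness and truncation for vertex operators\<close>

lemma exp_neg_0 [simp]: "exp_neg k \<beta> s 0 = 0"
  by (simp add: exp_neg_def op_exp_zero_arg)

lemma exp_pos_0 [simp]: "exp_pos k \<beta> s 0 = 0"
  by (simp add: exp_pos_def op_exp_zero_arg)

lemma dmult_exp_pos_mult_gexp:
  "dmult (exp_pos k \<beta>) (mult_gexp \<beta>) s v = exp_pos k \<beta> s (gexp \<beta> * v)"
  unfolding dmult_def by (subst Sum_any_only[of s]) (auto simp: mult_gexp_def)

lemma Y_gexp_eq:
  "Y_gexp k \<beta> s v = Sum_any (\<lambda>p. exp_neg k \<beta> p (exp_pos k \<beta> (s - p) (gexp \<beta> * v)))"
  by (simp add: Y_gexp_def dmult_def[of "exp_neg k \<beta>"] dmult_exp_pos_mult_gexp)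

text \<open>The creation factor has no negative powers of z, and for large p the annihilation factor
  pushes the weight of \<open>v\<close> below 0.\<close>

lemma finite_exp_support:
  "finite {p. exp_neg k \<beta> p (exp_pos k \<beta>' (s - p) v) \<noteq> 0}"
proof -
  obtain t where "v \<in> wt_le t" using ex_wt_le by blast
  then have "exp_pos k \<beta>' (s - p) v \<in> wt_le (t + (s - p) + 0)" for p
    using raises_exp_pos unfolding raises_def by blast
  then have "exp_pos k \<beta>' (s - p) v = 0" if "p > t + s" for p
    using that by (intro wt_le_neg) auto
  then have "exp_neg k \<beta> p (exp_pos k \<beta>' (s - p) v) = 0" if "p > t + s" for p
    using that by simp
  moreover have "exp_neg k \<beta> p w = 0" if "p < 0" for p w
    using that by (simp add: exp_neg_def)
  ultimately have "{p. exp_neg k \<beta> p (exp_pos k \<beta>' (s - p) v) \<noteq> 0} \<subseteq> {0..t + s}"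
    using not_le by fastforce
  then show ?thesis by (rule finite_subset) simp
qed

lemma raises_Y_gexp: "raises (Y_gexp k \<beta>) 0"
proof -
  have "raises (mult_gexp \<beta>) 0"
    by (auto simp: raises_def mult_gexp_def gexp_times_wt_le pm.subspace_0[OF subspace_wt_le])
  from raises_dmult[OF raises_exp_neg raises_dmult[OF raises_exp_pos this]] show ?thesis
    by (simp add: Y_gexp_def)
qed

lemma raises_Y_list: "raises (Y_list k xs \<beta>) (\<Sum>(a, m)\<leftarrow>xs. int m + 1)"
proof (induction xs)
  case (Cons am xs)
  obtain a m where am: "am = (a, m)" by fastforce
  show ?case
    using raises_dmult[OF raises_heis_neg Cons.IH, of m k a]
      raises_dmult[OF Cons.IH raises_heis_nonneg, of m k a] am
    by (auto simp: raises_def add_ac intro!: pm.subspace_add[OF subspace_wt_le])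
qed (simp add: raises_Y_gexp)

text \<open>Truncation: for very negative s the weight bound on the coefficient is negative.\<close>

lemma Y_list_bounded_below:
  obtains N where "\<And>s. s < N \<Longrightarrow> Y_list k xs \<beta> s v = 0"
proof -
  obtain t where t: "v \<in> wt_le t" using ex_wt_le by blast
  let ?d = "\<Sum>(a, m)\<leftarrow>xs. int m + 1"
  have "Y_list k xs \<beta> s v = 0" if "s < - t - ?d" for s
  proof (rule wt_le_neg)
    show "Y_list k xs \<beta> s v \<in> wt_le (t + s + ?d)" using raises_Y_list t unfolding raises_def by blast
  qed (use that in linarith)
  then show ?thesis by (rule that)
qed

text \<open>The zero vector lies in every step of the weight filtration, so the bound from
  \<open>raises_Y_list\<close> may be taken negative.\<close>

lemma Y_list_zero_arg [simp]: "Y_list k xs \<beta> s 0 = 0"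
proof -
  have "Y_list k xs \<beta> s 0 \<in> wt_le (t + s + (\<Sum>(a, m)\<leftarrow>xs. int m + 1))" for t
    using raises_Y_list pm.subspace_0[OF subspace_wt_le] unfolding raises_def by blast
  from this[of "- s - (\<Sum>(a, m)\<leftarrow>xs. int m + 1) - 1"] show ?thesis by (rule wt_le_neg) simp
qed

section \<open>The action on the top level\<close>

text \<open>The part a(0) z^(-1) of the field a(z) has m-th divided derivative (-1)^m a(0) z^(-m-1),
  hence the sign.\<close>

definition top_factor :: "int \<Rightarrow> 'n::finite latC \<Rightarrow> 'n cartan \<times> nat \<Rightarrow> complex" where
  "top_factor k \<gamma> = (\<lambda>(a, m). (- 1) ^ m * form k a (incl_C \<gamma>))"

text \<open>The factors are evaluated at \<gamma> and not at \<alpha> + \<gamma>, because normal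
  ordering lets the modes a(0) act before e^\<alpha>.\<close>

definition top_basis :: "int \<Rightarrow> 'n::finite latC \<Rightarrow> 'n voa_basis \<Rightarrow> 'n latC \<Rightarrow>\<^sub>0 complex" where
  "top_basis k \<gamma> = (\<lambda>(M, \<alpha>). Poly_Mapping.single (\<alpha> + \<gamma>)
     (\<Prod>(b, m)\<in>#M. top_factor k \<gamma> (bvec b, m)))"

text \<open>
  The zero mode \<open>u\<^bsub>wt u - 1\<^esub>\<close> of a homogeneous vector \<open>u\<close>, evaluated at the top level vector
  \<open>e\<^sup>\<gamma>\<close>: as creation operators raise the weight, only the modes \<open>\<alpha>(0)\<close> contribute.
\<close>

definition top_act :: "int \<Rightarrow> 'n::finite latC \<Rightarrow> 'n voa \<Rightarrow> 'n latC \<Rightarrow>\<^sub>0 complex" where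
  "top_act k \<gamma> = lin_ext (top_basis k \<gamma>)"

lemma top_act_linear: "pm_linear (top_act k \<gamma>)"
  by (simp add: top_act_def[abs_def] lin_ext_linear)

lemmas top_act_add = pm_linear_add[OF top_act_linear]
  and top_act_scale = pm_linear_scale[OF top_act_linear]
  and top_act_0 [simp] = pm_linear_0[OF top_act_linear]
  and top_act_sum = pm_linear_sum[OF top_act_linear]
  and top_act_Sum_any = pm_linear_Sum_any[OF top_act_linear]

lemma top_act_single [simp]: "top_act k \<gamma> (Poly_Mapping.single x a) = a *\<^sub>p top_basis k \<gamma> x"
  by (simp add: top_act_def)

section \<open>The bilinear form in coordinates\<close>

lemma form_bvec_left: "form k (bvec b) x = (\<Sum>b'\<in>UNIV. x $ b' * of_int (basis_form k b b'))"
proof -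
  have "(\<Sum>b'\<in>UNIV. bvec b $ a * x $ b' * of_int (basis_form k a b'))
      = (if a = b then \<Sum>b'\<in>UNIV. x $ b' * of_int (basis_form k a b') else 0)" for a
    by (simp add: bvec_def axis_def)
  then show ?thesis by (simp add: form_def)
qed

lemma form_bvec: "form k a x = (\<Sum>b\<in>UNIV. a $ b * form k (bvec b) x)"
  unfolding form_bvec_left by (simp add: form_def sum_distrib_left mult.assoc)

lemma form_add_right: "form k a (x + y) = form k a x + form k a y"
  by (simp add: form_def algebra_simps sum.distrib)

lemma incl_C_nth: "incl_C \<beta> $ b = (case b of Inl i \<Rightarrow> of_int (\<beta> $ i) | Inr i \<Rightarrow> 0)"
  by (auto simp: incl_C_def bvec_def axis_def if_distrib sum.delta cong: if_cong split: sum.splits)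

lemma incl_C_add: "incl_C (\<beta> + \<gamma>) = incl_C \<beta> + incl_C \<gamma>"
  by (simp add: vec_eq_iff incl_C_nth split: sum.splits)

lemma incl_C_0 [simp]: "incl_C 0 = 0"
  by (simp add: vec_eq_iff incl_C_nth split: sum.splits)

lemma sum_UNIV_Plus: "(\<Sum>b\<in>UNIV. f b) = (\<Sum>i\<in>UNIV. f (Inl i)) + (\<Sum>i\<in>UNIV. f (Inr i))"
  for f :: "'a::finite + 'b::finite \<Rightarrow> complex"
  by (subst UNIV_Plus_UNIV[symmetric], subst sum.Plus) auto

lemma form_bvec_Inl: "form k (bvec (Inl i)) x = of_int k * x $ Inr i"
  by (simp add: form_bvec_left sum_UNIV_Plus if_distrib[of of_int] if_distrib[of "\<lambda>z. _ * z"]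
      mult.commute cong: if_cong)

lemma form_bvec_Inr: "form k (bvec (Inr i)) x = of_int k * x $ Inl i"
  by (simp add: form_bvec_left sum_UNIV_Plus if_distrib[of of_int] if_distrib[of "\<lambda>z. _ * z"]
      mult.commute cong: if_cong)

text \<open>L_C is isotropic; this is why the creation part of Y(e^\<beta>, z) becomes trivial on
  the top level.\<close>

lemma form_incl_C: "form k (incl_C \<beta>) (incl_C \<gamma>) = 0"
  by (subst form_bvec) (simp add: sum_UNIV_Plus form_bvec_Inl form_bvec_Inr incl_C_nth)

section \<open>Modes and exponentials on the top level\<close>

lemma top_basis_add_mset:
  "top_basis k \<gamma> (add_mset (b, m) M, \<beta>) = top_factor k \<gamma> (bvec b, m) *\<^sub>p top_basis k \<gamma> (M, \<beta>)"
  by (simp add: top_basis_def)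

lemma top_act_heis_neg:
  "top_act k \<gamma> (heis k a (- int m - 1) v) = ((- 1) ^ m * form k a (incl_C \<gamma>)) *\<^sub>p top_act k \<gamma> v"
proof -
  have "top_act k \<gamma> (heis k a (- int m - 1) (Poly_Mapping.single (M, \<beta>) 1))
      = (\<Sum>b\<in>UNIV. (a $ b * ((- 1) ^ m * form k (bvec b) (incl_C \<gamma>))) *\<^sub>p top_basis k \<gamma> (M, \<beta>))" for M \<beta>
    by (simp add: heis_def top_act_sum top_basis_add_mset top_factor_def nat_add_distrib)
  also have "(\<Sum>b\<in>UNIV. (a $ b * ((- 1) ^ m * form k (bvec b) (incl_C \<gamma>))) *\<^sub>p top_basis k \<gamma> (M, \<beta>))
      = ((- 1) ^ m * form k a (incl_C \<gamma>)) *\<^sub>p top_basis k \<gamma> (M, \<beta>)" for M \<beta>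
    unfolding pm.scale_sum_left[symmetric] form_bvec[of k a]
    by (simp add: sum_distrib_left mult.left_commute)
  finally have "top_act k \<gamma> (heis k a (- int m - 1) (Poly_Mapping.single x 1))
      = ((- 1) ^ m * form k a (incl_C \<gamma>)) *\<^sub>p top_act k \<gamma> (Poly_Mapping.single x 1)" for x
    by (cases x) simp
  from pm_linear_eqI[OF pm_linear_comp[OF top_act_linear heis_linear] pm_linear_cmul[OF top_act_linear] this]
  show ?thesis .
qed

text \<open>A vector over e^\<beta> sends e^\<gamma> to a multiple of e^(\<beta>+\<gamma>), and (a,
  \<gamma>) + (a, \<beta>) is the eigenvalue of a(0) there. So the right side is a(0) applied after
  \<open>v\<close>; the two summands will come from the creation and annihilation halves of
  a(z).\<close>

lemma top_act_heis_0:
  "form k a (incl_C \<gamma>) *\<^sub>p top_act k \<gamma> v + top_act k \<gamma> (heis k a 0 v)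
   = lin_ext (\<lambda>\<delta>. Poly_Mapping.single \<delta> (form k a (incl_C \<delta>))) (top_act k \<gamma> v)"
proof (rule pm_linear_eqI[of "\<lambda>v. form k a (incl_C \<gamma>) *\<^sub>p top_act k \<gamma> v + top_act k \<gamma> (heis k a 0 v)"])
  show "pm_linear (\<lambda>v. form k a (incl_C \<gamma>) *\<^sub>p top_act k \<gamma> v + top_act k \<gamma> (heis k a 0 v))"
    by (rule pm_linear_plus[OF pm_linear_cmul[OF top_act_linear] pm_linear_comp[OF top_act_linear heis_linear]])
  show "pm_linear (\<lambda>v. lin_ext (\<lambda>\<delta>. Poly_Mapping.single \<delta> (form k a (incl_C \<delta>))) (top_act k \<gamma> v))"
    by (rule pm_linear_comp[OF lin_ext_linear top_act_linear])
  fix x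
  show "form k a (incl_C \<gamma>) *\<^sub>p top_act k \<gamma> (Poly_Mapping.single x 1)
      + top_act k \<gamma> (heis k a 0 (Poly_Mapping.single x 1))
    = lin_ext (\<lambda>\<delta>. Poly_Mapping.single \<delta> (form k a (incl_C \<delta>))) (top_act k \<gamma> (Poly_Mapping.single x 1))"
    by (cases x)
      (simp add: heis_def top_basis_def incl_C_add form_add_right algebra_simps flip: single_add)
qed

text \<open>Since a(-q-1) contributes (-1)^q (a, \<gamma>), the creation half of a(z) becomes (a,
  \<gamma>) / (1 + z), and its divided derivatives follow.\<close>

lemma top_act_divided_deriv_heis_neg:
  "top_act k \<gamma> (divided_deriv m (heis_neg k a) p v)
   = form k a (incl_C \<gamma>) *\<^sub>p neg_coeff m p *\<^sub>p top_act k \<gamma> v"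
proof (cases "p + int m \<ge> 0")
  case True
  then obtain q where q: "p + int m = int q" by (metis nonneg_int_cases)
  have "(complex_of_int (int q) gchoose m) = of_nat (q choose m)"
    by (simp add: binomial_gbinomial)
  then show ?thesis
    using top_act_heis_neg[of k \<gamma> a q v]
    by (simp add: divided_deriv_eq q heis_neg_def neg_coeff_def top_act_scale mult_ac)
qed (simp add: divided_deriv_eq heis_neg_def neg_coeff_def)

text \<open>By isotropy every \<beta>(-n) contributes 0, so only the constant term of the
  exponential survives.\<close>

lemma top_act_exp_neg: "top_act k \<gamma> (exp_neg k \<beta> p v) = (if p = 0 then top_act k \<gamma> v else 0)"
proof -
  define X where "X = (\<lambda>n w. (- (1 / (- of_nat n))) *\<^sub>p heis k (incl_C \<beta>) (- int n) w)"
  have X: "top_act k \<gamma> (X n w) = 0" if "n \<ge> 1" for n w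
    using top_act_heis_neg[of k \<gamma> "incl_C \<beta>" "n - 1" w] that
    by (simp add: X_def top_act_scale form_incl_C of_nat_diff)
  have pow: "top_act k \<gamma> (op_power X j q v) = 0" if "q \<ge> 1" for j q
    using that by (cases j) (auto simp: top_act_sum X intro!: sum.neutral)
  have "top_act k \<gamma> (op_exp X q v) = 0" if "q \<ge> 1" for q
    using pow[OF that] by (simp add: op_exp_def top_act_sum top_act_scale)
  then show ?thesis unfolding exp_neg_def X_def[symmetric] by (auto simp: op_exp_0)
qed

lemma top_act_gexp_times:
  "top_act k \<gamma> (gexp \<alpha> * v) = lin_ext (\<lambda>\<delta>. Poly_Mapping.single (\<alpha> + \<delta>) 1) (top_act k \<gamma> v)"
  by (rule pm_linear_eqI[OF pm_linear_comp[OF top_act_linear pm_linear_mult_left]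
      pm_linear_comp[OF lin_ext_linear top_act_linear]])
    (auto simp: gexp_def mult_single top_basis_def add_ac split: prod.splits)

lemma top_act_Y_gexp:
  "top_act k \<gamma> (Y_gexp k \<alpha> s v) = top_act k \<gamma> (exp_pos k \<alpha> s (gexp \<alpha> * v))"
  unfolding Y_gexp_eq top_act_Sum_any[OF finite_exp_support] top_act_exp_neg
  by (subst Sum_any_only[of 0]) auto

section \<open>Vertex operators on the top level\<close>

lemma gchoose_minus_one: "((- 1 :: complex) gchoose m) = (- 1) ^ m"
  by (simp add: gbinomial_minus flip: binomial_gbinomial)

lemma finite_dmult_neg_support:
  "finite {p. divided_deriv m (heis_neg k a) p (Y_list k xs \<alpha> (s - p) v) \<noteq> 0}"
proof -
  obtain N where N: "\<And>s. s < N \<Longrightarrow> Y_list k xs \<alpha> s v = 0" using Y_list_bounded_below[of k xs \<alpha> v] by blast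
  have "{p. divided_deriv m (heis_neg k a) p (Y_list k xs \<alpha> (s - p) v) \<noteq> 0} \<subseteq> {- int m..s - N}"
  proof
    fix p assume p: "p \<in> {p. divided_deriv m (heis_neg k a) p (Y_list k xs \<alpha> (s - p) v) \<noteq> 0}"
    then have "p + int m \<ge> 0" by (auto simp: divided_deriv_eq heis_neg_def split: if_splits)
    moreover have "\<not> s - p < N" using p N[of "s - p"] by (auto simp: divided_deriv_eq heis_neg_def split: if_splits)
    ultimately show "p \<in> {- int m..s - N}" by auto
  qed
  then show ?thesis by (rule finite_subset) simp
qed

lemma finite_heis_nonneg_support: "finite {t. divided_deriv m (heis_nonneg k a) t v \<noteq> 0}"
proof -
  obtain w where w: "v \<in> wt_le w" using ex_wt_le by blast
  have "{t. divided_deriv m (heis_nonneg k a) t v \<noteq> 0} \<subseteq> {- int m - 1 - w..- int m - 1}"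
  proof
    fix t assume t: "t \<in> {t. divided_deriv m (heis_nonneg k a) t v \<noteq> 0}"
    then have "t + int m \<le> -1" by (auto simp: divided_deriv_eq heis_nonneg_def split: if_splits)
    moreover have "divided_deriv m (heis_nonneg k a) t v \<in> wt_le (w + t + (int m + 1))"
      using raises_heis_nonneg w unfolding raises_def by blast
    with t have "w + t + (int m + 1) \<ge> 0" using wt_le_neg not_le by blast
    ultimately show "t \<in> {- int m - 1 - w..- int m - 1}" by auto
  qed
  then show ?thesis by (rule finite_subset) simp
qed

definition top_prod :: "int \<Rightarrow> 'n::finite latC \<Rightarrow> ('n cartan \<times> nat) list \<Rightarrow> complex" where
  "top_prod k \<gamma> xs = (\<Prod>x\<leftarrow>xs. top_factor k \<gamma> x)"

text \<open>
  Applied to the top level, \<open>(1 + z)\<^bsup>wt u\<^esup> Y(u, z) v\<close> becomes a polynomial in \<open>1 / z\<close> whose constant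
  term is the composition of the actions of \<open>u\<close> and \<open>v\<close>: this gives both the vanishing of the
  residue defining \<open>u \<circ> v\<close> and the multiplicativity of \<^const>\<open>top_act\<close>.
\<close>

lemma top_act_Y_list:
  fixes v :: "'n::finite voa"
  defines "n \<equiv> \<lambda>xs :: ('n cartan \<times> nat) list. \<Sum>(a, m)\<leftarrow>xs. Suc m"
  shows "s > 0 \<Longrightarrow> (mul1z ^^ n xs) (\<lambda>s. top_act k \<gamma> (Y_list k xs \<alpha> s v)) s = 0"
    and "(mul1z ^^ n xs) (\<lambda>s. top_act k \<gamma> (Y_list k xs \<alpha> s v)) 0
       = lin_ext (\<lambda>\<delta>. Poly_Mapping.single (\<alpha> + \<delta>) (top_prod k \<delta> xs)) (top_act k \<gamma> v)"
proof -
  have "(s > 0 \<longrightarrow> (mul1z ^^ n xs) (\<lambda>s. top_act k \<gamma> (Y_list k xs \<alpha> s v)) s = 0) \<and>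
    (mul1z ^^ n xs) (\<lambda>s. top_act k \<gamma> (Y_list k xs \<alpha> s v)) 0
       = lin_ext (\<lambda>\<delta>. Poly_Mapping.single (\<alpha> + \<delta>) (top_prod k \<delta> xs)) (top_act k \<gamma> v)" for s
  proof (induction xs arbitrary: s v)
    case Nil
    \<comment> \<open>What remains of Y(e^\<alpha>, z) is the annihilation exponential, which has no
      positive powers of z and constant term 1.\<close>
    show ?case
      by (simp add: n_def top_act_Y_gexp top_prod_def top_act_gexp_times[symmetric])
        (simp add: exp_pos_def op_exp_0)
  next
    case (Cons x xs)
    obtain a m where x: "x = (a, m)" by fastforce
    define f where "f = form k a (incl_C \<gamma>)"
    define C where "C = (\<lambda>\<delta>. Poly_Mapping.single (\<alpha> + \<delta>) (top_prod k \<delta> xs))"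
    define B where "B = divided_deriv m (heis_nonneg k a)"
    define y where "y = (\<lambda>w s. top_act k \<gamma> (Y_list k xs \<alpha> s w))"
    \<comment> \<open>The exponent - m - 1 belongs to the mode a(0). It is included even if its term
      vanishes, so that it can be split off below.\<close>
    define T where "T = insert (- int m - 1) {t. B t v \<noteq> 0}"
    have finT: "finite T" by (simp add: T_def B_def finite_heis_nonneg_support)
    have T_le: "t \<le> - int m - 1" if "t \<in> T" for t
      using that by (auto simp: T_def B_def divided_deriv_eq heis_nonneg_def split: if_splits)
    have IH: "s > 0 \<Longrightarrow> (mul1z ^^ n xs) (y w) s = 0" "(mul1z ^^ n xs) (y w) 0 = lin_ext C (top_act k \<gamma> w)"
      for s w using Cons.IH by (auto simp: y_def C_def)
    have y1: "top_act k \<gamma> (dmult (divided_deriv m (heis_neg k a)) (Y_list k xs \<alpha>) s v)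
        = f *\<^sub>p Sum_any (\<lambda>p. neg_coeff m p *\<^sub>p y v (s - p))" for s
    proof -
      obtain N where N: "\<And>s. s < N \<Longrightarrow> Y_list k xs \<alpha> s v = 0" using Y_list_bounded_below[of k xs \<alpha> v] by blast
      have "finite {p. neg_coeff m p *\<^sub>p y v (s - p) \<noteq> 0}"
        by (rule finite_conv_support[of N]) (simp add: y_def N)
      then have "f *\<^sub>p Sum_any (\<lambda>p. neg_coeff m p *\<^sub>p y v (s - p))
          = Sum_any (\<lambda>p. f *\<^sub>p neg_coeff m p *\<^sub>p y v (s - p))"
        by (rule pm_linear_Sum_any[OF pm_linear_cmul[OF pm_linear_id]])
      then show ?thesis
        unfolding dmult_def top_act_Sum_any[OF finite_dmult_neg_support] top_act_divided_deriv_heis_neg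
        by (simp add: f_def y_def)
    qed
    have y2: "top_act k \<gamma> (dmult (Y_list k xs \<alpha>) B s v) = (\<Sum>t\<in>T. y (B t v) (s - t))" for s
    proof -
      have inj: "inj_on (\<lambda>t. s - t) T" by (auto simp: inj_on_def)
      have sub: "{p. Y_list k xs \<alpha> p (B (s - p) v) \<noteq> 0} \<subseteq> (\<lambda>t. s - t) ` T"
      proof
        fix p assume p: "p \<in> {p. Y_list k xs \<alpha> p (B (s - p) v) \<noteq> 0}"
        then have "B (s - p) v \<noteq> 0" by auto
        then have "s - p \<in> T" by (simp add: T_def)
        then show "p \<in> (\<lambda>t. s - t) ` T" by (rule rev_image_eqI) simp
      qed
      have "dmult (Y_list k xs \<alpha>) B s v = (\<Sum>p\<in>(\<lambda>t. s - t) ` T. Y_list k xs \<alpha> p (B (s - p) v))"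
        unfolding dmult_def using finT sub by (intro Sum_any.expand_superset) auto
      then show ?thesis by (simp add: sum.reindex[OF inj] top_act_sum y_def)
    qed
    have n_Cons: "n (x # xs) = n xs + Suc m" "n (x # xs) = Suc m + n xs" by (simp_all add: n_def x)
    \<comment> \<open>Creation half: m + 1 of the factors 1 + z cancel the pole at z = -1, and the
      others are left for the induction hypothesis.\<close>
    have D1: "(mul1z ^^ n (x # xs)) (\<lambda>s. f *\<^sub>p Sum_any (\<lambda>p. neg_coeff m p *\<^sub>p y v (s - p))) s
        = (f * (-1) ^ m) *\<^sub>p (mul1z ^^ n xs) (y v) s" for s
    proof -
      obtain N where N: "\<And>s. s < N \<Longrightarrow> Y_list k xs \<alpha> s v = 0" using Y_list_bounded_below[of k xs \<alpha> v] by blast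
      have "(mul1z ^^ Suc m) (\<lambda>s. Sum_any (\<lambda>p. neg_coeff m p *\<^sub>p y v (s - p))) = (\<lambda>s. (- 1) ^ m *\<^sub>p y v s)"
        by (rule mul1z_funpow_conv[of N]) (simp add: y_def N)
      then show ?thesis
        unfolding mul1z_funpow_scale n_Cons(1) funpow_add o_apply
        by (simp add: mul1z_funpow_scale del: funpow.simps)
    qed
    \<comment> \<open>Annihilation half: the induction hypothesis for the vector
      \<open>B t v\<close> leaves no positive powers after \<open>n xs\<close> factors. The other m
      + 1 factors raise the degree by m + 1, which z^t with t at most - m - 1 compensates.\<close>
    have D2: "(mul1z ^^ n (x # xs)) (\<lambda>s. \<Sum>t\<in>T. y (B t v) (s - t)) s
        = (\<Sum>t\<in>T. (mul1z ^^ Suc m) ((mul1z ^^ n xs) (y (B t v))) (s - t))" for s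
      unfolding mul1z_funpow_sum mul1z_funpow_shift n_Cons(2) funpow_add o_apply ..
    have D2_above: "(mul1z ^^ Suc m) ((mul1z ^^ n xs) (y (B t v))) (s - t) = 0"
      if "t \<in> T" "s > 0 \<or> s = 0 \<and> t \<noteq> - int m - 1" for s t
      using T_le[OF that(1)] that(2) by (intro mul1z_funpow_above(1) IH(1)) auto
    \<comment> \<open>Only the leading coefficient of the term t = - m - 1, that is, of a(0),
      reaches degree 0.\<close>
    have D2_0: "(\<Sum>t\<in>T. (mul1z ^^ Suc m) ((mul1z ^^ n xs) (y (B t v))) (0 - t))
        = lin_ext C (top_act k \<gamma> (B (- int m - 1) v))"
    proof -
      have "(\<Sum>t\<in>T. (mul1z ^^ Suc m) ((mul1z ^^ n xs) (y (B t v))) (0 - t))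
          = (mul1z ^^ Suc m) ((mul1z ^^ n xs) (y (B (- int m - 1) v))) (int (Suc m))"
        using D2_above[where s = 0]
        by (subst sum.mono_neutral_right[of T "{- int m - 1}"])
          (use finT in \<open>auto simp: T_def add.commute simp del: funpow.simps\<close>)
      also have "\<dots> = lin_ext C (top_act k \<gamma> (B (- int m - 1) v))"
        by (subst mul1z_funpow_above(2)) (auto simp: IH simp del: funpow.simps)
      finally show ?thesis .
    qed
    have B0: "B (- int m - 1) v = (- 1) ^ m *\<^sub>p heis k a 0 v"
      by (simp add: B_def divided_deriv_eq heis_nonneg_def gchoose_minus_one)
    have split: "(mul1z ^^ n (x # xs)) (\<lambda>s. top_act k \<gamma> (Y_list k (x # xs) \<alpha> s v)) s
        = (f * (-1) ^ m) *\<^sub>p (mul1z ^^ n xs) (y v) s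
        + (\<Sum>t\<in>T. (mul1z ^^ Suc m) ((mul1z ^^ n xs) (y (B t v))) (s - t))" for s
      unfolding x Y_list.simps top_act_add y1 B_def[symmetric] y2 mul1z_funpow_add
      unfolding x[symmetric] D1 D2 ..
    \<comment> \<open>The new factor a acts on the output of \<open>v\<close> before the remaining
      factors \<open>C\<close>; \<open>top_act_heis_0\<close> splits its eigenvalue into the
      contributions of the two halves.\<close>
    have "lin_ext (\<lambda>\<delta>. Poly_Mapping.single (\<alpha> + \<delta>) (top_prod k \<delta> (x # xs))) (top_act k \<gamma> v)
        = (-1) ^ m *\<^sub>p lin_ext C (lin_ext (\<lambda>\<delta>. Poly_Mapping.single \<delta> (form k a (incl_C \<delta>))) (top_act k \<gamma> v))"
      unfolding lin_ext_lin_ext lin_ext_fun_scale[symmetric]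
      by (simp add: C_def top_prod_def top_factor_def x mult_ac)
    also have "\<dots> = (f * (-1) ^ m) *\<^sub>p lin_ext C (top_act k \<gamma> v) + lin_ext C (top_act k \<gamma> (B (- int m - 1) v))"
      unfolding top_act_heis_0[symmetric] B0 top_act_scale lin_ext_add lin_ext_scale
      by (simp add: pm.scale_right_distrib f_def mult.commute)
    finally have eq: "lin_ext (\<lambda>\<delta>. Poly_Mapping.single (\<alpha> + \<delta>) (top_prod k \<delta> (x # xs))) (top_act k \<gamma> v)
        = (f * (-1) ^ m) *\<^sub>p lin_ext C (top_act k \<gamma> v) + lin_ext C (top_act k \<gamma> (B (- int m - 1) v))" .
    have "(\<Sum>t\<in>T. (mul1z ^^ Suc m) ((mul1z ^^ n xs) (y (B t v))) (s - t)) = 0" if "s > 0"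
      by (rule sum.neutral) (use D2_above that in blast)
    then show ?case unfolding split D2_0 IH(2) eq using IH(1) by simp
  qed
  then show "s > 0 \<Longrightarrow> (mul1z ^^ n xs) (\<lambda>s. top_act k \<gamma> (Y_list k xs \<alpha> s v)) s = 0"
    "(mul1z ^^ n xs) (\<lambda>s. top_act k \<gamma> (Y_list k xs \<alpha> s v)) 0
       = lin_ext (\<lambda>\<delta>. Poly_Mapping.single (\<alpha> + \<delta>) (top_prod k \<delta> xs)) (top_act k \<gamma> v)" by auto
qed

lemma top_prod_mset:
  "mset xs = M \<Longrightarrow> top_prod k \<gamma> (map (\<lambda>(b, m). (bvec b, m)) xs) = (\<Prod>(b, m)\<in>#M. top_factor k \<gamma> (bvec b, m))"
  unfolding top_prod_def prod_mset_prod_list[symmetric]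
  by (auto simp: comp_def case_prod_unfold simp flip: mset_map)

lemma top_act_Y_basis:
  shows "s > 0 \<Longrightarrow> (mul1z ^^ weight x) (\<lambda>s. top_act k \<gamma> (Y_basis k x s v)) s = 0"
    and "(mul1z ^^ weight x) (\<lambda>s. top_act k \<gamma> (Y_basis k x s v)) 0
       = lin_ext (\<lambda>\<delta>. top_basis k \<delta> x) (top_act k \<gamma> v)"
proof -
  obtain M \<alpha> where x: "x = (M, \<alpha>)" by fastforce
  define xs where "xs = (SOME xs. mset xs = M)"
  have xs: "mset xs = M" unfolding xs_def by (rule someI_ex[OF ex_mset])
  let ?xs = "map (\<lambda>(b, m). (bvec b, m)) xs"
  have w: "weight x = (\<Sum>(a, m)\<leftarrow>?xs. Suc m)"
    by (auto simp: x comp_def case_prod_unfold simp flip: xs sum_mset_sum_list mset_map)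
  have Y: "Y_basis k x = Y_list k ?xs \<alpha>"
    by (simp add: x xs_def)
  have top: "top_basis k \<delta> x = Poly_Mapping.single (\<alpha> + \<delta>) (top_prod k \<delta> ?xs)" for \<delta>
    by (simp add: x top_basis_def top_prod_mset[OF xs])
  show "s > 0 \<Longrightarrow> (mul1z ^^ weight x) (\<lambda>s. top_act k \<gamma> (Y_basis k x s v)) s = 0"
    unfolding w Y by (rule top_act_Y_list(1))
  show "(mul1z ^^ weight x) (\<lambda>s. top_act k \<gamma> (Y_basis k x s v)) 0
       = lin_ext (\<lambda>\<delta>. top_basis k \<delta> x) (top_act k \<gamma> v)"
    unfolding w Y top by (rule top_act_Y_list(2))
qed

section \<open>The Zhu products on the top level\<close>

lemma mul1z_funpow_lin_ext:
  "(mul1z ^^ n) (\<lambda>s. lin_ext (\<lambda>x. y x s) u) s = lin_ext (\<lambda>x. (mul1z ^^ n) (y x) s) u"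
  by (simp add: lin_ext_def mul1z_funpow_sum mul1z_funpow_scale)

lemma top_act_Y: "top_act k \<gamma> (Y k u s v) = lin_ext (\<lambda>x. top_act k \<gamma> (Y_basis k x s v)) u"
  by (simp add: Y_def pm_linear_lin_ext_arg[OF top_act_linear])

lemma lin_ext_cong: "(\<And>x. x \<in> Poly_Mapping.keys u \<Longrightarrow> f x = g x) \<Longrightarrow> lin_ext f u = lin_ext g u"
  by (simp add: lin_ext_def)

lemma lin_ext_swap: "lin_ext (\<lambda>x. lin_ext (f x) v) u = lin_ext (\<lambda>d. lin_ext (\<lambda>x. f x d) u) v"
  by (simp add: lin_ext_def pm.scale_sum_right sum.swap[of _ "Poly_Mapping.keys v"] mult.commute)

text \<open>The residue is the coefficient of z in (1 + z)^n Y(u, z) v, and on the top level no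
  positive powers remain.\<close>

lemma top_act_circ:
  assumes "u \<in> hom_space n"
  shows "top_act k \<gamma> (zhu_circ k n u v) = 0"
proof -
  have "top_act k \<gamma> (zhu_circ k n u v) = (mul1z ^^ n) (\<lambda>s. top_act k \<gamma> (Y k u s v)) 1"
    by (simp add: zhu_circ_def top_act_sum top_act_scale vmode_def mul1z_funpow)
  also have "\<dots> = lin_ext (\<lambda>x. (mul1z ^^ n) (\<lambda>s. top_act k \<gamma> (Y_basis k x s v)) 1) u"
    by (simp add: top_act_Y mul1z_funpow_lin_ext)
  also have "\<dots> = lin_ext (\<lambda>x. 0) u"
    using assms by (intro lin_ext_cong) (auto simp: hom_space_def intro!: top_act_Y_basis(1))
  finally show ?thesis by simp
qed

lemma top_act_star:
  assumes "u \<in> hom_space n"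
  shows "top_act k \<gamma> (zhu_star k n u v) = lin_ext (\<lambda>\<delta>. top_act k \<delta> u) (top_act k \<gamma> v)"
proof -
  have "top_act k \<gamma> (zhu_star k n u v) = (mul1z ^^ n) (\<lambda>s. top_act k \<gamma> (Y k u s v)) 0"
    by (simp add: zhu_star_def top_act_sum top_act_scale vmode_def mul1z_funpow)
  also have "\<dots> = lin_ext (\<lambda>x. (mul1z ^^ n) (\<lambda>s. top_act k \<gamma> (Y_basis k x s v)) 0) u"
    by (simp add: top_act_Y mul1z_funpow_lin_ext)
  also have "\<dots> = lin_ext (\<lambda>x. lin_ext (\<lambda>\<delta>. top_basis k \<delta> x) (top_act k \<gamma> v)) u"
    using assms by (intro lin_ext_cong) (auto simp: hom_space_def intro!: top_act_Y_basis(2))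
  also have "\<dots> = lin_ext (\<lambda>\<delta>. top_act k \<delta> u) (top_act k \<gamma> v)"
    unfolding top_act_def by (rule lin_ext_swap)
  finally show ?thesis .
qed

lemma hom_comp_in_hom_space: "hom_comp n u \<in> hom_space n"
proof -
  have "hom_comp n u \<in> supp {x. weight x = n}"
    unfolding hom_comp_def by (intro pm.subspace_sum[OF subspace_supp]) auto
  then show ?thesis by (auto simp: supp_def hom_space_def)
qed

lemma sum_hom_comp: "(\<Sum>n\<in>weight ` Poly_Mapping.keys u. hom_comp n u) = u"
  unfolding hom_comp_def
  by (subst sum.image_gen[symmetric]) (simp_all add: poly_mapping_sum_singles)

text \<open>The right side is the composite of the two operators on the top level, with
  \<open>v\<close> acting first. Homogeneous components reduce it to
  \<open>top_act_star\<close>.\<close>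

lemma top_act_zhu_mult:
  "top_act k \<gamma> (zhu_mult k u v) = lin_ext (\<lambda>\<delta>. top_act k \<delta> u) (top_act k \<gamma> v)"
proof -
  have "top_act k \<gamma> (zhu_mult k u v)
      = (\<Sum>n\<in>weight ` Poly_Mapping.keys u. lin_ext (\<lambda>\<delta>. top_act k \<delta> (hom_comp n u)) (top_act k \<gamma> v))"
    by (simp add: zhu_mult_def top_act_sum top_act_star hom_comp_in_hom_space)
  also have "\<dots> = lin_ext (\<lambda>\<delta>. top_act k \<delta> (\<Sum>n\<in>weight ` Poly_Mapping.keys u. hom_comp n u)) (top_act k \<gamma> v)"
    by (simp add: top_act_sum lin_ext_def pm.scale_sum_right sum.swap[of _ "Poly_Mapping.keys _"])
  finally show ?thesis by (simp add: sum_hom_comp)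
qed

lemma subspace_zhu_O: "pm.subspace (zhu_O k)"
  unfolding zhu_O_def by (rule pm.subspace_span)

lemma zhu_circ_in_O: "u \<in> hom_space n \<Longrightarrow> zhu_circ k n u v \<in> zhu_O k"
  unfolding zhu_O_def by (intro pm.span_base) auto

lemma top_act_zhu_O:
  assumes "u \<in> zhu_O k" shows "top_act k \<gamma> u = 0"
proof -
  have "pm.subspace {u. top_act k \<gamma> u = 0}"
    by (simp add: pm.subspace_def top_act_add top_act_scale)
  then have "zhu_O k \<subseteq> {u. top_act k \<gamma> u = 0}"
    unfolding zhu_O_def by (intro pm.span_minimal) (auto simp: top_act_circ)
  with assms show ?thesis by blast
qed

section \<open>Reduction of the monomials modulo \<open>O(V)\<close>\<close>

lemma heis_zero_left [simp]:
  fixes v :: "'n::finite voa"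
  shows "heis k 0 n v = 0"
proof -
  have "heis_basis k (0 :: 'n cartan) n = (\<lambda>x. 0)"
  proof
    show "heis_basis k 0 n x = 0" for x by (cases x) (simp add: form_def)
  qed
  then show ?thesis by (simp add: heis_def)
qed

lemma op_exp_zero: "op_exp (\<lambda>n w. 0) p v = (if p = 0 then v else 0)"
proof -
  have "op_power (\<lambda>n w. 0) j p v = 0" if "p > 0" for j
    using that by (cases j) auto
  then show ?thesis by (auto simp: op_exp_def)
qed

lemma Y_gexp_0:
  fixes v :: "'n::finite voa"
  shows "Y_gexp k 0 s v = (if s = 0 then v else 0)"
proof -
  have "gexp 0 * v = v" by (simp add: gexp_times case_prod_unfold)
  moreover have "exp_neg k 0 p w = (if p = 0 then w else 0)" "exp_pos k 0 p w = (if p = 0 then w else 0)"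
    for p and w :: "'n voa" by (auto simp: exp_neg_def exp_pos_def op_exp_zero)
  ultimately show ?thesis
    unfolding Y_gexp_eq by (subst Sum_any_only[of 0]) auto
qed

text \<open>Y(e^0, z) is the identity and each coefficient meets just one of the two halves of a(z),
  so the normally ordered product is the divided derivative of a(z).\<close>

lemma Y_list_single_0: "Y_list k [(a, m)] 0 s v = (of_int (s + int m) gchoose m) *\<^sub>p heis k a (- (s + int m) - 1) v"
proof -
  have "dmult F (Y_gexp k 0) s v = F s v" if "\<And>p. F p 0 = 0" for F
    unfolding dmult_def by (subst Sum_any_only[of s]) (auto simp: Y_gexp_0 that)
  moreover have "dmult (Y_gexp k 0) F s v = F s v" for F
    unfolding dmult_def by (subst Sum_any_only[of 0]) (auto simp: Y_gexp_0)
  ultimately show ?thesis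
    by (simp add: divided_deriv_eq heis_neg_def heis_nonneg_def)
qed

lemma bvec_nth: "bvec b $ b' = (if b' = b then 1 else 0)"
  by (simp add: bvec_def axis_def)

lemma heis_bvec_neg:
  "heis k (bvec b) (- int m - 1) (Poly_Mapping.single (M, \<beta>) c) = Poly_Mapping.single (add_mset (b, m) M, \<beta>) c"
proof -
  have "(\<Sum>b'\<in>UNIV. Poly_Mapping.single (add_mset (b', m) M, \<beta>) (bvec b $ b'))
      = (\<Sum>b'\<in>UNIV. if b' = b then Poly_Mapping.single (add_mset (b, m) M, \<beta>) 1 else 0)"
    by (intro sum.cong) (auto simp: bvec_def axis_def)
  then show ?thesis by (simp add: heis_def nat_add_distrib)
qed

text \<open>Take u = b(-m-1) 1, of weight m + 1. The i-th term of u \<circ> v has coefficient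
  binom(m+1, i) binom(m+1-i, m), which is m + 1 for i = 0 and i = 1 and vanishes for larger
  i.\<close>

lemma creation_shift_in_O:
  "heis k (bvec b) (- int m - 2) v + heis k (bvec b) (- int m - 1) v \<in> zhu_O k"
proof -
  let ?u = "Poly_Mapping.single ({#(b, m)#}, 0) 1"
  define g where "g = (\<lambda>i. of_nat (Suc m choose i) *\<^sub>p
    (of_int (1 - int i + int m) gchoose m) *\<^sub>p heis k (bvec b) (- (1 - int i + int m) - 1) v)"
  have "zhu_circ k (Suc m) ?u v = (\<Sum>i\<le>Suc m. g i)"
    by (simp add: zhu_circ_def vmode_def Y_def g_def Y_list_single_0 del: Y_list.simps)
  also have "\<dots> = (\<Sum>i\<in>{0, 1}. g i)"
  proof (rule sum.mono_neutral_right)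
    show "\<forall>i\<in>{..Suc m} - {0, 1}. g i = 0"
    proof
      fix i assume "i \<in> {..Suc m} - {0, 1}"
      then obtain q where q: "1 - int i + int m = int q" "q < m"
        by (intro that[of "Suc m - i"]) auto
      then have "complex_of_int (1 - int i + int m) = of_nat q" by (simp only: of_int_of_nat_eq)
      with q(2) show "g i = 0" unfolding g_def by (simp only: binomial_gbinomial[symmetric]) simp
    qed
  qed auto
  also have "\<dots> = of_nat (Suc m) *\<^sub>p (heis k (bvec b) (- int m - 2) v + heis k (bvec b) (- int m - 1) v)"
  proof -
    have "(of_nat (Suc m) gchoose m :: complex) = of_nat (Suc m)" "(of_nat m gchoose m :: complex) = 1"
      by (simp_all flip: binomial_gbinomial del: of_nat_Suc)
    moreover have "1 - int 0 + int m = int (Suc m)" "1 - int 1 + int m = int m" by auto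
    moreover have "- int (Suc m) - 1 = - int m - 2" by simp
    ultimately have "g 0 = of_nat (Suc m) *\<^sub>p heis k (bvec b) (- int m - 2) v"
        "g 1 = of_nat (Suc m) *\<^sub>p heis k (bvec b) (- int m - 1) v"
      unfolding g_def by (simp_all only: of_int_of_nat_eq choose_one binomial_n_0 of_nat_1 pm.scale_one)
    then show ?thesis by (simp only: pm.scale_right_distrib) simp
  qed
  finally have "zhu_circ k (Suc m) ?u v
      = of_nat (Suc m) *\<^sub>p (heis k (bvec b) (- int m - 2) v + heis k (bvec b) (- int m - 1) v)" .
  moreover have "zhu_circ k (Suc m) ?u v \<in> zhu_O k"
    by (intro zhu_circ_in_O) (auto simp: hom_space_def)
  ultimately have "(1 / of_nat (Suc m)) *\<^sub>p of_nat (Suc m) *\<^sub>p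
      (heis k (bvec b) (- int m - 2) v + heis k (bvec b) (- int m - 1) v) \<in> zhu_O k"
    by (simp only: pm.subspace_scale[OF subspace_zhu_O])
  then show ?thesis by (simp del: of_nat_Suc)
qed

lemma creation_reduce:
  "Poly_Mapping.single (add_mset (b, m) M, \<beta>) 1 - (- 1) ^ m *\<^sub>p Poly_Mapping.single (add_mset (b, 0) M, \<beta>) 1
   \<in> zhu_O k"
proof (induction m)
  case (Suc m)
  let ?s = "\<lambda>m. Poly_Mapping.single (add_mset (b, m) M, \<beta>) 1"
  have "?s (Suc m) + ?s m \<in> zhu_O k"
    using creation_shift_in_O[of k b m "Poly_Mapping.single (M, \<beta>) 1"] heis_bvec_neg[of k b "Suc m"] heis_bvec_neg[of k b m]
    by (simp add: algebra_simps)
  from pm.subspace_diff[OF subspace_zhu_O this Suc.IH]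
  show ?case by (simp add: algebra_simps single_uminus)
qed (simp add: pm.subspace_0[OF subspace_zhu_O])

section \<open>Monomials with a factor c_i(-n) lie in O(V)\<close>

definition d_le :: "int \<Rightarrow> 'n voa_basis set" where
  "d_le t = {(M, \<beta>). int (size {#x \<in># M. \<not> isl (fst x)#}) \<le> t}"

text \<open>\<open>isl\<close> singles out the c-variables. Such monomials will be placed in O(V) by
  induction on the number of d-variables.\<close>

definition cd_le :: "int \<Rightarrow> 'n voa_basis set" where
  "cd_le t = {(M, \<beta>) \<in> d_le t. \<exists>x\<in>#M. isl (fst x)}"

lemma cd_le_subset: "cd_le t \<subseteq> d_le t"
  by (auto simp: cd_le_def)

lemma d_le_mono: "t \<le> t' \<Longrightarrow> d_le t \<subseteq> d_le t'"
  by (auto simp: d_le_def)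

text \<open>A creation operator from L_C adds a c-variable and no d-variable.\<close>

lemma heis_incl_C_neg:
  assumes "n \<ge> 1" "v \<in> supp (d_le t)"
  shows "heis k (incl_C \<beta>) (- int n) v \<in> supp (cd_le t)"
  unfolding heis_def
proof (rule lin_ext_supp[OF _ assms(2)])
  fix x :: "'a voa_basis" assume x: "x \<in> d_le t"
  obtain M \<gamma> where [simp]: "x = (M, \<gamma>)" by fastforce
  have "Poly_Mapping.single (add_mset (b, n - 1) M, \<gamma>) (incl_C \<beta> $ b) \<in> supp (cd_le t)" for b
    using x by (cases b) (auto simp: incl_C_nth cd_le_def d_le_def)
  then show "heis_basis k (incl_C \<beta>) (- int n) x \<in> supp (cd_le t)"
    using assms(1) by (auto intro!: pm.subspace_sum[OF subspace_supp])
qed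

lemma form_incl_C_bvec_Inl: "form k (incl_C \<beta>) (bvec (Inl i)) = 0"
  by (subst form_bvec) (simp add: sum_UNIV_Plus form_bvec_Inl form_bvec_Inr incl_C_nth bvec_nth)

text \<open>An annihilation operator from L_C pairs to zero with c-variables, so every surviving
  term has lost a d-variable.\<close>

lemma heis_incl_C_pos:
  assumes "n \<ge> 1" "v \<in> supp (d_le t)"
  shows "heis k (incl_C \<beta>) (int n) v \<in> supp (d_le (t - 1))"
  unfolding heis_def
proof (rule lin_ext_supp[OF _ assms(2)])
  fix x :: "'a voa_basis" assume x: "x \<in> d_le t"
  obtain M \<gamma> where [simp]: "x = (M, \<gamma>)" by fastforce
  have "Poly_Mapping.single (M - {#(b, n - 1)#}, \<gamma>)
      (of_int n * form k (incl_C \<beta>) (bvec b) * of_nat (count M (b, n - 1))) \<in> supp (d_le (t - 1))" for b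
  proof (cases b)
    case (Inr j)
    show ?thesis
    proof (cases "(b, n - 1) \<in># M")
      case True
      then obtain M' where "M = add_mset (b, n - 1) M'" by (metis multi_member_split)
      with x Inr show ?thesis by (auto simp: d_le_def)
    qed (simp add: not_in_iff)
  qed (simp add: form_incl_C_bvec_Inl)
  then show "heis_basis k (incl_C \<beta>) (int n) x \<in> supp (d_le (t - 1))"
    using assms(1) by (auto intro!: pm.subspace_sum[OF subspace_supp])
qed

lemma exp_neg_cd_le:
  assumes "p \<ge> 1" "v \<in> supp (d_le t)"
  shows "exp_neg k \<beta> p v \<in> supp (cd_le t)"
proof -
  define X where "X = (\<lambda>n w. (- (1 / (- of_nat n))) *\<^sub>p heis k (incl_C \<beta>) (- int n) w)"
  have X: "X n w \<in> supp (cd_le t)" if "n \<ge> 1" "w \<in> supp (d_le t)" for n w t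
    unfolding X_def by (intro pm.subspace_scale[OF subspace_supp] heis_incl_C_neg that)
  then have "X n w \<in> supp (d_le t)" if "n \<ge> 1" "w \<in> supp (d_le t)" for n w t
    using that by (blast intro: supp_mono[OF cd_le_subset])
  then have "op_power X j q v \<in> supp (d_le (t + 0 * int q))" for j q
    by (intro op_power_in_subspace[where W = "\<lambda>t. supp (d_le t)"] subspace_supp assms(2)) simp
  \<comment> \<open>In positive degree only products with at least one factor occur; the outermost
    factor supplies the c-variable.\<close>
  then have "op_power X j (nat p) v \<in> supp (cd_le t)" for j
    using assms(1) X by (cases j) (auto intro!: pm.subspace_sum[OF subspace_supp])
  then show ?thesis
    using assms(1) unfolding exp_neg_def X_def[symmetric] op_exp_def
    by (auto intro!: pm.subspace_sum[OF subspace_supp] pm.subspace_scale[OF subspace_supp])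
qed

lemma exp_pos_d_le:
  assumes "p \<le> - 1" "v \<in> supp (d_le t)"
  shows "exp_pos k \<beta> p v \<in> supp (d_le (t - 1))"
proof -
  define X where "X = (\<lambda>n w. (- (1 / of_nat n)) *\<^sub>p heis k (incl_C \<beta>) (int n) w)"
  have X: "X n w \<in> supp (d_le (t - 1))" if "n \<ge> 1" "w \<in> supp (d_le t)" for n w t
    unfolding X_def by (intro pm.subspace_scale[OF subspace_supp] heis_incl_C_pos that)
  then have "X n w \<in> supp (d_le t)" if "n \<ge> 1" "w \<in> supp (d_le t)" for n w t
    using that by (blast intro: supp_mono[OF d_le_mono[of "t - 1" t, simplified]])
  then have "op_power X j q v \<in> supp (d_le (t + 0 * int q))" for j q
    by (intro op_power_in_subspace[where W = "\<lambda>t. supp (d_le t)"] subspace_supp assms(2)) simp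
  then have "op_power X j (nat (- p)) v \<in> supp (d_le (t - 1))" for j
    using assms(1) X by (cases j) (auto intro!: pm.subspace_sum[OF subspace_supp])
  then show ?thesis
    using assms(1) unfolding exp_pos_def X_def[symmetric] op_exp_def
    by (auto intro!: pm.subspace_sum[OF subspace_supp] pm.subspace_scale[OF subspace_supp])
qed

text \<open>As e^\<alpha> has weight 0, e^\<alpha> \<circ> v is the bare mode of index -2, that is,
  the coefficient of z.\<close>

lemma Y_gexp_in_O: "Y_gexp k \<alpha> 1 v \<in> zhu_O k"
proof -
  have "zhu_circ k 0 (gexp \<alpha>) v = Y_basis k ({#}, \<alpha>) 1 v"
    by (simp add: zhu_circ_def vmode_def Y_def gexp_def)
  then have "zhu_circ k 0 (gexp \<alpha>) v = Y_gexp k \<alpha> 1 v" by simp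
  moreover have "gexp \<alpha> \<in> hom_space 0" by (auto simp: gexp_def hom_space_def)
  ultimately show ?thesis using zhu_circ_in_O by metis
qed

text \<open>
  The leading term of \<open>e\<^bsup>c\<^sub>i\<^esup> \<circ> (e\<^bsup>-c\<^sub>i\<^esup> v)\<close> is \<open>c\<^sub>i(-1) v\<close>; all other terms contain a factor \<open>c\<^sub>j(-n)\<close>
  and fewer factors \<open>d\<^sub>j(-n)\<close> than \<open>v\<close>.
\<close>

lemma c_monomial_in_O: "supp (cd_le (int t - 1) :: 'n::finite voa_basis set) \<subseteq> zhu_O k"
proof (induction t)
  \<comment> \<open>The bound starts at -1, where no monomial qualifies.\<close>
  case 0
  have "supp (cd_le (- 1) :: 'n voa_basis set) = {0}" by (auto simp: cd_le_def d_le_def supp_def)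
  then show ?case using pm.subspace_0[OF subspace_zhu_O] by auto
next
  case (Suc t)
  have "Poly_Mapping.single x 1 \<in> zhu_O k" if x: "x \<in> cd_le (int t)" for x :: "'n voa_basis"
  proof -
    obtain M i m \<beta> where x_eq: "x = (add_mset (Inl i, m) M, \<beta>)" and M: "(M, \<beta>) \<in> d_le (int t)"
    proof -
      obtain M' \<beta> where M': "x = (M', \<beta>)" by fastforce
      with x obtain y where "y \<in># M'" "isl (fst y)" by (auto simp: cd_le_def)
      then obtain i m M where "M' = add_mset (Inl i, m) M" by (cases y) (auto simp: isl_def dest!: multi_member_split)
      then show ?thesis using that[of i m M \<beta>] x M' by (auto simp: cd_le_def d_le_def)
    qed
    let ?w = "Poly_Mapping.single (M, \<beta>) 1" and ?\<alpha> = "axis i 1"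
    define f where "f = (\<lambda>p. exp_neg k ?\<alpha> p (exp_pos k ?\<alpha> (1 - p) ?w))"
    have incl: "incl_C ?\<alpha> = bvec (Inl i)"
      by (auto simp: vec_eq_iff incl_C_nth bvec_def axis_def split: sum.splits)
    have f1: "f 1 = Poly_Mapping.single (add_mset (Inl i, 0) M, \<beta>) 1"
      using heis_bvec_neg[of k "Inl i" 0 M \<beta> 1]
      by (simp add: f_def exp_pos_def op_exp_0) (simp add: exp_neg_def op_exp_def incl)
    have fin: "finite {p. f p \<noteq> 0}" unfolding f_def by (rule finite_exp_support)
    \<comment> \<open>The exponent is shifted by - c_i so that multiplication by e^(c_i) restores
      \<open>?w\<close>; \<open>f p\<close> is the part of creation degree p.\<close>
    have "Y_gexp k ?\<alpha> 1 (Poly_Mapping.single (M, \<beta> - ?\<alpha>) 1) = Sum_any f"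
      unfolding Y_gexp_eq f_def by (simp add: gexp_def mult_single)
    with Y_gexp_in_O have "Sum_any f \<in> zhu_O k" by metis
    moreover have "Sum_any (f(1 := 0)) \<in> zhu_O k"
    proof (rule Sum_any_in_subspace[OF subspace_zhu_O])
      fix p :: int
      \<comment> \<open>For p at most 0 the annihilation factor would need a positive power of z.
        For p at least 2 it removes a d-variable and the creation factor adds a c-variable, so the
        induction hypothesis applies.\<close>
      consider "p = 1" | "p \<le> 0" | "p \<ge> 2" by linarith
      then show "(f(1 := 0)) p \<in> zhu_O k"
      proof cases
        case 3
        then have "f p \<in> supp (cd_le (int t - 1))"
          unfolding f_def using M by (intro exp_neg_cd_le exp_pos_d_le) auto
        with Suc.IH 3 show ?thesis by auto
      qed (auto simp: f_def exp_pos_def pm.subspace_0[OF subspace_zhu_O])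
    qed
    moreover have "Sum_any f = f 1 + Sum_any (f(1 := 0))"
    proof -
      have "finite {p. (f(1 := 0)) p \<noteq> 0}" by (rule finite_subset[OF _ fin]) auto
      then have "Sum_any ((f(1 := 0))(1 := f 1)) = f 1 + Sum_any (f(1 := 0))"
        by (rule Sum_any.update) simp
      also have "(f(1 := 0))(1 := f 1) = f" by simp
      finally show ?thesis .
    qed
    ultimately have "f 1 \<in> zhu_O k"
      using pm.subspace_diff[OF subspace_zhu_O, of "Sum_any f" k "Sum_any (f(1 := 0))"] by simp
    \<comment> \<open>So far c_i(-1) is treated; \<open>creation_reduce\<close> passes from it to
      c_i(-m-1).\<close>
    then have "(- 1) ^ m *\<^sub>p f 1 \<in> zhu_O k" by (rule pm.subspace_scale[OF subspace_zhu_O])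
    from pm.subspace_add[OF subspace_zhu_O creation_reduce[of "Inl i" m M \<beta> k] this]
    show ?thesis by (simp add: f1 x_eq)
  qed
  then have "u \<in> zhu_O k" if "Poly_Mapping.keys u \<subseteq> cd_le (int t)" for u :: "'n voa"
    using that by (blast intro: poly_mapping_in_subspace[OF subspace_zhu_O])
  then show ?case by (simp add: supp_def subset_iff)
qed

text \<open>The index pairs are those of \<open>normal_word\<close>, so that both families can be
  compared through the same operators \<open>top_op\<close>.\<close>

definition d_monomial :: "'n multiset \<times> 'n::finite latC \<Rightarrow> 'n voa" where
  "d_monomial = (\<lambda>(m, \<alpha>). Poly_Mapping.single (image_mset (\<lambda>i. (Inr i, 0)) m, \<alpha>) 1)"

lemma subspace_span_mod:
  assumes "pm.subspace J" shows "pm.subspace {u. \<exists>p. u - lin_ext b p \<in> J}"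
  unfolding pm.subspace_def
proof (intro conjI allI ballI)
  show "0 \<in> {u. \<exists>p. u - lin_ext b p \<in> J}"
    using pm.subspace_0[OF assms] by (auto intro!: exI[of _ 0])
next
  fix u v assume "u \<in> {u. \<exists>p. u - lin_ext b p \<in> J}" "v \<in> {u. \<exists>p. u - lin_ext b p \<in> J}"
  then obtain p q where "u - lin_ext b p \<in> J" "v - lin_ext b q \<in> J" by auto
  from pm.subspace_add[OF assms this] show "u + v \<in> {u. \<exists>p. u - lin_ext b p \<in> J}"
    by (auto intro!: exI[of _ "p + q"] simp: lin_ext_add algebra_simps)
next
  fix u a assume "u \<in> {u. \<exists>p. u - lin_ext b p \<in> J}"
  then obtain p where "u - lin_ext b p \<in> J" by auto
  from pm.subspace_scale[OF assms this, of a] show "a *\<^sub>p u \<in> {u. \<exists>p. u - lin_ext b p \<in> J}"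
    by (auto intro!: exI[of _ "a *\<^sub>p p"] simp: lin_ext_scale pm.scale_right_diff_distrib)
qed

lemma d_monomials_span: "\<exists>p. u - lin_ext d_monomial p \<in> zhu_O k"
proof -
  let ?S = "{u. \<exists>p. u - lin_ext d_monomial p \<in> zhu_O k}"
  have sub: "pm.subspace ?S" by (rule subspace_span_mod[OF subspace_zhu_O])
  have O: "u \<in> ?S" if "u \<in> zhu_O k" for u using that by (auto intro!: exI[of _ 0])
  let ?d = "image_mset (\<lambda>i. (Inr i, 0))"
  \<comment> \<open>\<open>M\<close> holds the variables still to be reduced, \<open>N\<close> the
    indices of those already turned into d_i(-1).\<close>
  have d: "Poly_Mapping.single (M + ?d N, \<beta>) 1 \<in> ?S" if "\<forall>x\<in>#M. \<not> isl (fst x)" for M N \<beta>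
    using that
  proof (induction M arbitrary: N)
    case empty
    have "Poly_Mapping.single (?d N, \<beta>) 1 - lin_ext d_monomial (Poly_Mapping.single (N, \<beta>) 1) = 0"
      by (simp add: d_monomial_def)
    then have "Poly_Mapping.single (?d N, \<beta>) 1 - lin_ext d_monomial (Poly_Mapping.single (N, \<beta>) 1) \<in> zhu_O k"
      by (simp only: pm.subspace_0[OF subspace_zhu_O])
    then have "Poly_Mapping.single (?d N, \<beta>) 1 \<in> ?S" by (intro CollectI exI)
    then show ?case by simp
  next
    case (add x M)
    then obtain i m where x: "x = (Inr i, m)" by (cases x; cases "fst x") auto
    have "Poly_Mapping.single (M + ?d (add_mset i N), \<beta>) 1 \<in> ?S"
      using add.IH[of "add_mset i N"] add.prems by simp
    from pm.subspace_add[OF sub O[OF creation_reduce[of "Inr i" m "M + ?d N" \<beta>]] pm.subspace_scale[OF sub this, of "(- 1) ^ m"]]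
    show ?case by (simp add: x)
  qed
  have "Poly_Mapping.single x 1 \<in> ?S" for x
  proof (cases "\<forall>y\<in>#fst x. \<not> isl (fst y)")
    case True
    from d[OF True, of "{#}" "snd x"] show ?thesis by simp
  next
    case False
    then have "x \<in> cd_le (int (Suc (size (fst x))) - 1)"
      by (auto simp: cd_le_def d_le_def size_filter_mset_lesseq)
    then have "Poly_Mapping.single x 1 \<in> supp (cd_le (int (Suc (size (fst x))) - 1))"
      by (simp del: of_nat_Suc)
    with c_monomial_in_O O show ?thesis by blast
  qed
  from poly_mapping_in_subspace[OF sub this] show ?thesis by simp
qed

section \<open>Linear independence of the top level actions\<close>

text \<open>Dedekind's argument: the relation at h g minus \<psi>_j(h) times the relation at g loses
  its j-th term and has coefficients a_i (\<psi>_i(h) - \<psi>_j(h)).\<close>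

lemma characters_independent:
  fixes \<psi> :: "'i \<Rightarrow> 'g \<Rightarrow> 'f::field"
  assumes "finite S" "inj_on \<psi> S"
    and mult: "\<And>i g h. i \<in> S \<Longrightarrow> \<psi> i (mul g h) = \<psi> i g * \<psi> i h"
    and nonzero: "\<And>i. i \<in> S \<Longrightarrow> \<exists>g. \<psi> i g \<noteq> 0"
    and "\<And>g. (\<Sum>i\<in>S. a i * \<psi> i g) = 0"
  shows "\<forall>i\<in>S. a i = 0"
  using assms
proof (induction S arbitrary: a rule: finite_induct)
  case (insert j S)
  have zero: "a i = 0" if i: "i \<in> S" for i
  proof -
    have "\<psi> i \<noteq> \<psi> j" using insert.prems(1) insert.hyps(2) i by (auto simp: inj_on_def)
    then obtain h where h: "\<psi> i h \<noteq> \<psi> j h" by auto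
    have "(\<Sum>i\<in>S. (a i * (\<psi> i h - \<psi> j h)) * \<psi> i g) = 0" for g
    proof -
      have "(\<Sum>i\<in>S. (a i * (\<psi> i h - \<psi> j h)) * \<psi> i g)
          = (\<Sum>i\<in>S. a i * \<psi> i (mul h g)) - \<psi> j h * (\<Sum>i\<in>S. a i * \<psi> i g)"
        by (simp add: insert.prems(2) sum_distrib_left sum_subtractf[symmetric] algebra_simps)
      also have "\<dots> = 0"
      proof -
        have "(\<Sum>i\<in>S. a i * \<psi> i g) = - (a j * \<psi> j g)" for g
          using insert.prems(4)[of g] insert.hyps by (simp add: eq_neg_iff_add_eq_0 add.commute)
        then show ?thesis by (simp only:) (simp add: insert.prems(2)[OF insertI1])
      qed
      finally show ?thesis .
    qed
    then have "\<forall>i\<in>S. a i * (\<psi> i h - \<psi> j h) = 0"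
      using insert.prems by (intro insert.IH) (auto simp: inj_on_def)
    with i h show ?thesis by auto
  qed
  moreover have "a j = 0"
  proof -
    obtain g where "\<psi> j g \<noteq> 0" using insert.prems(3) by blast
    with insert.prems(4)[of g] insert.hyps zero show ?thesis by simp
  qed
  ultimately show ?case by auto
qed simp

definition top_op :: "int \<Rightarrow> 'n::finite latC \<Rightarrow> 'n multiset \<times> 'n latC \<Rightarrow> 'n latC \<Rightarrow>\<^sub>0 complex" where
  "top_op k \<gamma> = (\<lambda>(m, \<alpha>). Poly_Mapping.single (\<alpha> + \<gamma>) (\<Prod>i\<in>#m. of_int k * of_int (\<gamma> $ i)))"

lemma top_act_d_monomial: "top_act k \<gamma> (d_monomial x) = top_op k \<gamma> x"
  by (auto simp: d_monomial_def top_basis_def top_op_def top_factor_def form_bvec_Inr incl_C_nth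
      image_mset.compositionality comp_def split: prod.splits)

text \<open>For fixed \<alpha> the scalars are monomials in \<gamma> up to the nonzero factors
  \<open>of_int k ^ size m\<close>, so \<open>characters_independent\<close> applies to the
  coefficients.\<close>

lemma top_op_independent:
  fixes p :: "'n::finite multiset \<times> 'n latC \<Rightarrow>\<^sub>0 complex"
  assumes "k \<noteq> 0" and zero: "\<And>\<gamma>. lin_ext (top_op k \<gamma>) p = 0"
  shows "p = 0"
proof (rule poly_mapping_eqI)
  fix x :: "'n multiset \<times> 'n latC"
  obtain m0 \<alpha> where x: "x = (m0, \<alpha>)" by fastforce
  \<comment> \<open>\<open>m0\<close> is inserted so that the conclusion covers it even when it does
    not occur in \<open>p\<close>.\<close>
  define S where "S = insert m0 (fst ` Poly_Mapping.keys p)"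
  define \<psi> where "\<psi> = (\<lambda>(m :: 'n multiset) (\<gamma> :: 'n latC). \<Prod>i\<in>#m. complex_of_int (\<gamma> $ i))"
  have finS: "finite S" by (simp add: S_def)
  have sub: "Poly_Mapping.keys p \<subseteq> S \<times> snd ` Poly_Mapping.keys p"
    by (force simp: S_def)
  have inj: "inj_on \<psi> S"
  proof (rule inj_onI)
    fix m m' assume eq: "\<psi> m = \<psi> m'"
    \<comment> \<open>Evaluation at the vector with entry 2 at i and 1 elsewhere recovers the
      multiplicity of i in m.\<close>
    have "\<psi> m (\<chi> j. if j = i then 2 else 1) = 2 ^ count m i" for m i
      by (induction m) (auto simp: \<psi>_def)
    from this[of m] this[of m'] eq have "(2 :: complex) ^ count m i = 2 ^ count m' i" for i by metis
    then have "(of_nat (2 ^ count m i) :: complex) = of_nat (2 ^ count m' i)" for i by simp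
    then have "(2 :: nat) ^ count m i = 2 ^ count m' i" for i by (simp only: of_nat_eq_iff)
    then have "count m i = count m' i" for i by simp
    then show "m = m'" by (rule multiset_eqI)
  qed
  have mult: "\<psi> m (\<chi> i. \<gamma> $ i * \<delta> $ i) = \<psi> m \<gamma> * \<psi> m \<delta>" for m and \<gamma> \<delta> :: "'n latC"
    by (simp add: \<psi>_def prod_mset.distrib)
  have nonzero: "\<exists>\<gamma>. \<psi> m \<gamma> \<noteq> 0" for m
    by (rule exI[of _ "\<chi> i. 1"]) (simp add: \<psi>_def)
  have prod: "(\<Prod>i\<in>#m. of_int k * of_int (\<gamma> $ i)) = of_int k ^ size m * \<psi> m \<gamma>" for m and \<gamma> :: "'n latC"
    by (simp add: \<psi>_def prod_mset.distrib)
  have "(\<Sum>m\<in>S. (Poly_Mapping.lookup p (m, \<alpha>) * of_int k ^ size m) * \<psi> m \<gamma>) = 0" for \<gamma>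
  proof -
    \<comment> \<open>The coefficient of e^(\<alpha>+\<gamma>) sees only the pairs with second
      component \<alpha>, because these are the ones that shift by \<alpha>.\<close>
    have "0 = Poly_Mapping.lookup (lin_ext (top_op k \<gamma>) p) (\<alpha> + \<gamma>)" by (simp add: zero)
    also have "\<dots> = (\<Sum>x\<in>S \<times> snd ` Poly_Mapping.keys p.
        Poly_Mapping.lookup p x * Poly_Mapping.lookup (top_op k \<gamma> x) (\<alpha> + \<gamma>))"
      using sub by (simp add: lin_ext_superset[of "S \<times> snd ` Poly_Mapping.keys p"] finS lookup_sum)
    also have "\<dots> = (\<Sum>m\<in>S. \<Sum>\<beta>\<in>snd ` Poly_Mapping.keys p.
        if \<beta> = \<alpha> then Poly_Mapping.lookup p (m, \<alpha>) * (of_int k ^ size m * \<psi> m \<gamma>) else 0)"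
      unfolding sum.cartesian_product
      by (intro sum.cong refl) (auto simp: top_op_def lookup_single prod when_def)
    also have "\<dots> = (\<Sum>m\<in>S. (Poly_Mapping.lookup p (m, \<alpha>) * of_int k ^ size m) * \<psi> m \<gamma>)"
    proof (intro sum.cong refl)
      fix m
      have "Poly_Mapping.lookup p (m, \<alpha>) = 0" if "\<alpha> \<notin> snd ` Poly_Mapping.keys p"
        using that by (metis image_eqI in_keys_iff snd_conv)
      then show "(\<Sum>\<beta>\<in>snd ` Poly_Mapping.keys p.
          if \<beta> = \<alpha> then Poly_Mapping.lookup p (m, \<alpha>) * (of_int k ^ size m * \<psi> m \<gamma>) else 0)
        = (Poly_Mapping.lookup p (m, \<alpha>) * of_int k ^ size m) * \<psi> m \<gamma>"
        by simp
    qed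
    finally show ?thesis by simp
  qed
  with finS inj mult nonzero have "\<forall>m\<in>S. Poly_Mapping.lookup p (m, \<alpha>) * of_int k ^ size m = 0"
    by (intro characters_independent[where \<psi> = \<psi> and mul = "\<lambda>\<gamma> \<delta>. \<chi> i. \<gamma> $ i * \<delta> $ i"])
  moreover have "m0 \<in> S" by (simp add: S_def)
  ultimately have "Poly_Mapping.lookup p (m0, \<alpha>) * of_int k ^ size m0 = 0" by blast
  then show "Poly_Mapping.lookup p x = Poly_Mapping.lookup 0 x"
    using assms(1) by (simp add: x)
qed

text \<open>A family that spans modulo \<open>J\<close> and acts through the independent operators
  \<open>T\<close> leaves no room for a kernel beyond \<open>J\<close>; the range then depends on
  \<open>T\<close> alone. Both V and the free algebra are instances with the same
  \<open>T\<close>.\<close>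

lemma kernel_and_range:
  fixes \<Phi> :: "'g \<Rightarrow> ('x \<Rightarrow>\<^sub>0 complex) \<Rightarrow> ('y \<Rightarrow>\<^sub>0 complex)"
  assumes lin: "\<And>g. pm_linear (\<Phi> g)"
    and J: "pm.subspace J" "\<And>g u. u \<in> J \<Longrightarrow> \<Phi> g u = 0"
    and span: "\<And>u. \<exists>p. u - lin_ext b p \<in> J"
    and b: "\<And>g y. \<Phi> g (b y) = T g y"
    and indep: "\<And>p. (\<And>g. lin_ext (T g) p = 0) \<Longrightarrow> p = 0"
  shows "J = {u. \<forall>g. \<Phi> g u = 0}"
    and "range (\<lambda>u g. \<Phi> g u) = range (\<lambda>p g. lin_ext (T g) p)"
proof -
  have \<Phi>b: "\<Phi> g (lin_ext b p) = lin_ext (T g) p" for g p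
    by (simp add: pm_linear_lin_ext_arg[OF lin] b)
  have \<Phi>: "\<Phi> g u = lin_ext (T g) p" if "u - lin_ext b p \<in> J" for g u p
    using J(2)[OF that, of g] by (simp add: pm_linear_diff[OF lin] \<Phi>b)
  show "J = {u. \<forall>g. \<Phi> g u = 0}"
  proof (intro equalityI subsetI)
    fix u assume u: "u \<in> {u. \<forall>g. \<Phi> g u = 0}"
    obtain p where p: "u - lin_ext b p \<in> J" using span by blast
    have "p = 0" using \<Phi>[OF p] u by (intro indep) auto
    with p show "u \<in> J" by simp
  qed (use J(2) in auto)
  show "range (\<lambda>u g. \<Phi> g u) = range (\<lambda>p g. lin_ext (T g) p)"
  proof (intro equalityI subsetI)
    fix f assume "f \<in> range (\<lambda>u g. \<Phi> g u)"
    then obtain u where f: "f = (\<lambda>g. \<Phi> g u)" by blast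
    obtain p where "u - lin_ext b p \<in> J" using span by blast
    from \<Phi>[OF this] show "f \<in> range (\<lambda>p g. lin_ext (T g) p)" by (auto simp: f)
  next
    fix f assume "f \<in> range (\<lambda>p g. lin_ext (T g) p)"
    then show "f \<in> range (\<lambda>u g. \<Phi> g u)" by (auto simp flip: \<Phi>b)
  qed
qed

section \<open>The presented algebra\<close>

text \<open>The natural representation on the group algebra of L_C: e_\<alpha> shifts, and d_i is
  diagonal with eigenvalue (d_i, \<gamma>).\<close>

fun gen_act :: "int \<Rightarrow> 'n::finite gen \<Rightarrow> 'n latC \<Rightarrow> 'n latC \<Rightarrow>\<^sub>0 complex" where
  "gen_act k (GenE \<alpha>) \<gamma> = Poly_Mapping.single (\<alpha> + \<gamma>) 1"
| "gen_act k (GenD i) \<gamma> = Poly_Mapping.single \<gamma> (of_int k * of_int (\<gamma> $ i))"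

fun word_act :: "int \<Rightarrow> 'n::finite latC \<Rightarrow> 'n gen free_monoid \<Rightarrow> 'n latC \<Rightarrow>\<^sub>0 complex" where
  "word_act k \<gamma> (Word gs) = foldr (\<lambda>g. lin_ext (gen_act k g)) gs (Poly_Mapping.single \<gamma> 1)"

definition free_act :: "int \<Rightarrow> 'n::finite latC \<Rightarrow> 'n gen free_alg \<Rightarrow> 'n latC \<Rightarrow>\<^sub>0 complex" where
  "free_act k \<gamma> = lin_ext (word_act k \<gamma>)"

lemma free_act_linear: "pm_linear (free_act k \<gamma>)"
  by (simp add: free_act_def[abs_def] lin_ext_linear)

lemma free_act_single [simp]: "free_act k \<gamma> (Poly_Mapping.single w a) = a *\<^sub>p word_act k \<gamma> w"
  by (simp add: free_act_def)

lemma foldr_gen_act: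
  "foldr (\<lambda>g. lin_ext (gen_act k g)) gs u = lin_ext (\<lambda>\<gamma>. word_act k \<gamma> (Word gs)) u"
  by (induction gs) (simp_all add: lin_ext_lin_ext)

lemma word_act_plus: "word_act k \<gamma> (w + w') = lin_ext (\<lambda>\<delta>. word_act k \<delta> w) (word_act k \<gamma> w')"
  by (cases w; cases w') (simp add: foldr_gen_act[symmetric] del: word_act.simps, simp)

text \<open>The rightmost letter acts first, so concatenation of words is composition of operators;
  bilinearity extends this from words.\<close>

lemma free_act_mult: "free_act k \<gamma> (f * g) = lin_ext (\<lambda>\<delta>. free_act k \<delta> f) (free_act k \<gamma> g)"
proof -
  have *: "free_act k \<gamma> (Poly_Mapping.single w 1 * Poly_Mapping.single w' 1)
      = lin_ext (\<lambda>\<delta>. free_act k \<delta> (Poly_Mapping.single w 1)) (free_act k \<gamma> (Poly_Mapping.single w' 1))"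
    for w w' :: "'a gen free_monoid"
    by (simp add: mult_single word_act_plus)
  have **: "free_act k \<gamma> (Poly_Mapping.single w 1 * g)
      = lin_ext (\<lambda>\<delta>. free_act k \<delta> (Poly_Mapping.single w 1)) (free_act k \<gamma> g)" for w :: "'a gen free_monoid"
    by (rule pm_linear_eqI[OF pm_linear_comp[OF free_act_linear pm_linear_mult_left] pm_linear_comp[OF lin_ext_linear free_act_linear] *])
  have lin: "pm_linear (\<lambda>f. lin_ext (\<lambda>\<delta>. free_act k \<delta> f) (free_act k \<gamma> g))"
    by (intro pm_linearI)
      (simp_all add: pm_linear_add[OF free_act_linear] pm_linear_scale[OF free_act_linear] lin_ext_fun_add lin_ext_fun_scale)
  show ?thesis
    by (rule pm_linear_eqI[OF pm_linear_comp[OF free_act_linear pm_linear_mult_right] lin **])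
qed

section \<open>The ideal of relations\<close>

lemma free_algebra_simps [simp]:
  "carrier free_algebra = UNIV" "x \<otimes>\<^bsub>free_algebra\<^esub> y = x * y" "\<one>\<^bsub>free_algebra\<^esub> = 1"
  "\<zero>\<^bsub>free_algebra\<^esub> = 0" "x \<oplus>\<^bsub>free_algebra\<^esub> y = x + y" "a \<odot>\<^bsub>free_algebra\<^esub> x = a *\<^sub>p x"
  by (simp_all add: free_algebra_def)

lemma ring_free_algebra: "ring free_algebra"
proof (rule ringI)
  show "abelian_group free_algebra"
    by (rule abelian_groupI) (auto simp: add_ac intro: exI[of _ "- _"])
  show "Group.monoid free_algebra"
    by (rule monoidI) (auto simp: mult.assoc)
qed (auto simp: algebra_simps)

lemma a_inv_free_algebra [simp]: "\<ominus>\<^bsub>free_algebra\<^esub> x = - x"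
proof -
  interpret ring free_algebra by (rule ring_free_algebra)
  show ?thesis by (rule minus_equality) auto
qed

abbreviation rel_ideal :: "int \<Rightarrow> 'n::finite gen free_alg set" where
  "rel_ideal k \<equiv> Idl\<^bsub>free_algebra\<^esub> (relations k)"

lemma ideal_rel_ideal: "ideal (rel_ideal k) free_algebra"
  by (rule ring.genideal_ideal[OF ring_free_algebra]) simp

lemma rel_ideal_base: "f \<in> relations k \<Longrightarrow> f \<in> rel_ideal k"
  using ring.genideal_self[OF ring_free_algebra, of "relations k"] by auto

lemma
  shows rel_ideal_mult_left: "f \<in> rel_ideal k \<Longrightarrow> g * f \<in> rel_ideal k"
    and rel_ideal_mult_right: "f \<in> rel_ideal k \<Longrightarrow> f * g \<in> rel_ideal k"
  using ideal.I_l_closed[OF ideal_rel_ideal, of f k g] ideal.I_r_closed[OF ideal_rel_ideal, of f k g] by auto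

text \<open>\<open>genideal\<close> yields a ring ideal; it is closed under scalars because these
  are multiplications by constants.\<close>

lemma subspace_rel_ideal: "pm.subspace (rel_ideal k)"
proof -
  interpret ideal "rel_ideal k" free_algebra by (rule ideal_rel_ideal)
  show ?thesis
    unfolding pm.subspace_def pm_scale_eq_mult
    using additive_subgroup.a_closed[OF is_additive_subgroup] additive_subgroup.zero_closed[OF is_additive_subgroup]
      rel_ideal_mult_left by auto
qed

text \<open>The common kernel over all \<gamma> is a two-sided ideal by
  \<open>free_act_mult\<close>, and it contains the defining relations.\<close>

lemma free_act_rel_ideal:
  fixes f :: "'n::finite gen free_alg"
  assumes "f \<in> rel_ideal k" shows "free_act k \<gamma> f = 0"
proof -
  let ?K = "{f :: 'n gen free_alg. \<forall>\<gamma>. free_act k \<gamma> f = 0}"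
  note lin = pm_linear_add[OF free_act_linear] pm_linear_diff[OF free_act_linear]
    pm_linear_scale[OF free_act_linear] pm_linear_0[OF free_act_linear]
  have "ideal ?K free_algebra"
  proof (rule idealI[OF ring_free_algebra])
    have "inv\<^bsub>add_monoid free_algebra\<^esub> f \<in> ?K" if "f \<in> ?K" for f
    proof -
      have "inv\<^bsub>add_monoid free_algebra\<^esub> f = 0 - f"
        by (simp only: a_inv_def[symmetric] a_inv_free_algebra) simp
      with that show ?thesis by (simp add: lin del: diff_0)
    qed
    then show "subgroup ?K (add_monoid free_algebra)"
      by (intro subgroup.intro) (auto simp: lin)
  qed (auto simp: free_act_mult)
  moreover have "relations k \<subseteq> ?K"
  proof -
    have "incl_C \<alpha> $ Inl i = of_int (\<alpha> $ i)" for \<alpha> :: "'n latC" and i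
      by (simp add: incl_C_nth)
    then show ?thesis
      unfolding relations_def
      by (auto simp: lin free_act_mult genE_def genD_def free_gen_def form_bvec_Inr add_ac
          simp flip: single_diff single_one) (auto simp: algebra_simps zero_free_monoid_def simp flip: single_diff)
  qed
  ultimately have "rel_ideal k \<subseteq> ?K" by (rule ring.genideal_minimal[OF ring_free_algebra])
  with assms show ?thesis by blast
qed

section \<open>Normal forms of words\<close>

definition word :: "'n gen list \<Rightarrow> 'n gen free_alg" where
  "word gs = Poly_Mapping.single (Word gs) 1"

lemma word_Cons: "word (g # gs) = free_gen g * word gs"
  by (simp add: word_def free_gen_def mult_single)

lemma word_Nil: "word [] = 1"
  by (simp add: word_def flip: zero_free_monoid_def)

lemma swap_GenD: "word (GenD i # GenD j # gs) - word (GenD j # GenD i # gs) \<in> rel_ideal k"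
proof -
  have "(genD i * genD j - genD j * genD i) * word gs \<in> rel_ideal k"
    by (intro rel_ideal_mult_right rel_ideal_base) (auto simp: relations_def)
  then show ?thesis by (simp add: word_Cons genD_def algebra_simps)
qed

lemma merge_GenE: "word (GenE \<alpha> # GenE \<beta> # gs) - word (GenE (\<alpha> + \<beta>) # gs) \<in> rel_ideal k"
proof -
  have "- ((genE (\<alpha> + \<beta>) - genE \<alpha> * genE \<beta>) * word gs) \<in> rel_ideal k"
    by (intro pm.subspace_neg[OF subspace_rel_ideal] rel_ideal_mult_right rel_ideal_base)
      (auto simp: relations_def)
  then show ?thesis by (simp add: word_Cons genE_def algebra_simps)
qed

lemma swap_GenD_GenE:
  "word (GenD i # GenE \<alpha> # gs) -
   (word (GenE \<alpha> # GenD i # gs) + form k (bvec (Inr i)) (incl_C \<alpha>) *\<^sub>p word (GenE \<alpha> # gs)) \<in> rel_ideal k"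
proof -
  have "(genD i * genE \<alpha> - genE \<alpha> * genD i - form k (bvec (Inr i)) (incl_C \<alpha>) *\<^sub>p genE \<alpha>) * word gs
      \<in> rel_ideal k"
    by (intro rel_ideal_mult_right rel_ideal_base) (auto simp: relations_def)
  then show ?thesis by (simp add: word_Cons genD_def genE_def algebra_simps pm_scale_mult_left)
qed

lemma rel_ideal_trans: "f - g \<in> rel_ideal k \<Longrightarrow> g - h \<in> rel_ideal k \<Longrightarrow> f - h \<in> rel_ideal k"
  using pm.subspace_add[OF subspace_rel_ideal] by fastforce

lemma rel_ideal_Cons:
  assumes "word gs - word hs \<in> rel_ideal k" shows "word (g # gs) - word (g # hs) \<in> rel_ideal k"
  using rel_ideal_mult_left[OF assms, of "free_gen g"] by (simp add: word_Cons algebra_simps)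

lemma move_GenD:
  "word (map GenD (xs @ i # ys)) - word (map GenD (i # xs @ ys)) \<in> rel_ideal k"
proof (induction xs)
  case (Cons j xs)
  from rel_ideal_trans[OF rel_ideal_Cons[OF Cons.IH, of "GenD j"]] swap_GenD[of j i _ k]
  show ?case by simp
qed (simp add: pm.subspace_0[OF subspace_rel_ideal])

lemma permute_GenD:
  "mset xs = mset ys \<Longrightarrow> word (map GenD xs) - word (map GenD ys) \<in> rel_ideal k"
proof (induction xs arbitrary: ys)
  case (Cons i xs)
  then have "i \<in> set ys" by (metis list.set_intros(1) set_mset_mset)
  then obtain ys1 ys2 where ys: "ys = ys1 @ i # ys2" by (meson split_list)
  with Cons.prems have "mset xs = mset (ys1 @ ys2)" by simp
  from rel_ideal_Cons[OF Cons.IH[OF this], of "GenD i"]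
  have "word (map GenD (i # xs)) - word (map GenD (i # ys1 @ ys2)) \<in> rel_ideal k" by simp
  from pm.subspace_diff[OF subspace_rel_ideal this move_GenD[of ys1 i ys2 k]]
  show ?case by (simp only: ys diff_diff_eq2 diff_add_cancel)
qed (simp add: pm.subspace_0[OF subspace_rel_ideal])

text \<open>The order of the letters d_i is an arbitrary choice; by \<open>permute_GenD\<close> it
  does not matter modulo the relations.\<close>

definition normal_word :: "'n multiset \<times> 'n latC \<Rightarrow> 'n gen free_alg" where
  "normal_word = (\<lambda>(m, \<alpha>). word (GenE \<alpha> # map GenD (SOME xs. mset xs = m)))"

lemma free_act_normal_word: "free_act k \<gamma> (normal_word x) = top_op k \<gamma> x"
proof -
  obtain m \<alpha> where x: "x = (m, \<alpha>)" by fastforce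
  define xs where "xs = (SOME xs. mset xs = m)"
  have m: "m = mset xs" unfolding xs_def by (rule someI_ex[OF ex_mset, symmetric])
  have "foldr (\<lambda>g. lin_ext (gen_act k g)) (map GenD xs) (Poly_Mapping.single \<gamma> 1)
      = Poly_Mapping.single \<gamma> (\<Prod>i\<in>#mset xs. of_int k * of_int (\<gamma> $ i))" for xs
    by (induction xs) (simp_all add: mult_ac)
  then show ?thesis
    by (simp add: x normal_word_def word_def top_op_def flip: xs_def m)
qed

text \<open>The empty word is e_0, and left multiplication by a generator preserves the span:
  e_\<alpha> merges with the leading e_\<beta>, and d_i moves past it at the cost of a scalar
  multiple of a normal word.\<close>

lemma normal_words_span:
  fixes u :: "'n::finite gen free_alg"
  shows "\<exists>p. u - lin_ext normal_word p \<in> rel_ideal k"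
proof -
  let ?S = "{u :: 'n gen free_alg. \<exists>p. u - lin_ext normal_word p \<in> rel_ideal k}"
  have sub: "pm.subspace ?S" by (rule subspace_span_mod[OF subspace_rel_ideal])
  have mod: "u \<in> ?S" if "u - v \<in> rel_ideal k" "v \<in> ?S" for u v
    using that rel_ideal_trans by blast
  have sorted: "word (GenE \<alpha> # map GenD xs) \<in> ?S" for \<alpha> xs
  proof -
    let ?ys = "SOME ys. mset ys = mset xs"
    have "mset ?ys = mset xs" by (rule someI_ex) auto
    then have "word (GenE \<alpha> # map GenD xs) - word (GenE \<alpha> # map GenD ?ys) \<in> rel_ideal k"
      by (intro rel_ideal_Cons permute_GenD) simp
    then have "word (GenE \<alpha> # map GenD xs) - lin_ext normal_word (Poly_Mapping.single (mset xs, \<alpha>) 1) \<in> rel_ideal k"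
      by (simp add: normal_word_def)
    then show ?thesis by blast
  qed
  have gen: "free_gen g * word (GenE \<beta> # map GenD xs) \<in> ?S" for g \<beta> xs
  proof (cases g)
    case (GenE \<alpha>)
    from mod[OF merge_GenE sorted] show ?thesis by (simp add: GenE flip: word_Cons)
  next
    case (GenD i)
    have "word (GenE \<beta> # map GenD (i # xs)) + form k (bvec (Inr i)) (incl_C \<beta>) *\<^sub>p word (GenE \<beta> # map GenD xs) \<in> ?S"
      by (intro pm.subspace_add[OF sub] pm.subspace_scale[OF sub] sorted)
    from mod[OF swap_GenD_GenE] this show ?thesis by (simp add: GenD flip: word_Cons)
  qed
  have "word gs \<in> ?S" for gs
  proof (induction gs)
    case Nil
    have "- ((genE 0 - 1) * word []) \<in> rel_ideal k"
      by (intro pm.subspace_neg[OF subspace_rel_ideal] rel_ideal_mult_right rel_ideal_base)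
        (auto simp: relations_def)
    then have "word [] - word (GenE 0 # map GenD []) \<in> rel_ideal k"
      by (simp add: word_Nil word_Cons genE_def)
    from mod[OF this sorted] show ?case .
  next
    case (Cons g gs)
    then obtain p where "word gs - lin_ext normal_word p \<in> rel_ideal k" by blast
    from rel_ideal_mult_left[OF this, of "free_gen g"]
    have "word (g # gs) - lin_ext (\<lambda>x. free_gen g * normal_word x) p \<in> rel_ideal k"
      by (simp add: word_Cons right_diff_distrib pm_linear_lin_ext_arg[OF pm_linear_mult_left])
    moreover have "lin_ext (\<lambda>x. free_gen g * normal_word x) p \<in> ?S"
    proof (rule lin_ext_in_subspace[OF sub])
      fix x :: "'n multiset \<times> 'n latC"
      have "normal_word x = word (GenE (snd x) # map GenD (SOME xs. mset xs = fst x))"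
        by (simp add: normal_word_def split_beta)
      then show "free_gen g * normal_word x \<in> ?S" by (simp only: gen)
    qed
    ultimately show ?case by (rule mod)
  qed
  then have "Poly_Mapping.single w 1 \<in> ?S" for w
    unfolding word_def by (cases w) blast
  from poly_mapping_in_subspace[OF sub this] show ?thesis by simp
qed

section \<open>Quotients by kernels\<close>

text \<open>Closure of \<open>Q\<close> is part of the notion because \<open>Q\<close> is a bare
  record whose algebra axioms are to be pulled back from \<open>B\<close>.\<close>

definition alg_embedding :: "('r, 'm) ring_scheme \<Rightarrow> ('r, 'a) module \<Rightarrow> ('r, 'b) module \<Rightarrow> ('a \<Rightarrow> 'b) \<Rightarrow> bool" where
  "alg_embedding R Q B h \<longleftrightarrow>
     inj_on h (carrier Q) \<and> h ` carrier Q \<subseteq> carrier B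
   \<and> (\<forall>x\<in>carrier Q. \<forall>y\<in>carrier Q.
        x \<otimes>\<^bsub>Q\<^esub> y \<in> carrier Q \<and> h (x \<otimes>\<^bsub>Q\<^esub> y) = h x \<otimes>\<^bsub>B\<^esub> h y
      \<and> x \<oplus>\<^bsub>Q\<^esub> y \<in> carrier Q \<and> h (x \<oplus>\<^bsub>Q\<^esub> y) = h x \<oplus>\<^bsub>B\<^esub> h y)
   \<and> (\<forall>a\<in>carrier R. \<forall>x\<in>carrier Q. a \<odot>\<^bsub>Q\<^esub> x \<in> carrier Q \<and> h (a \<odot>\<^bsub>Q\<^esub> x) = a \<odot>\<^bsub>B\<^esub> h x)
   \<and> \<one>\<^bsub>Q\<^esub> \<in> carrier Q \<and> h \<one>\<^bsub>Q\<^esub> = \<one>\<^bsub>B\<^esub>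
   \<and> \<zero>\<^bsub>Q\<^esub> \<in> carrier Q \<and> h \<zero>\<^bsub>Q\<^esub> = \<zero>\<^bsub>B\<^esub>"

text \<open>The equational axioms can be checked after applying the injective \<open>h\<close>; only
  additive inverses call for a witness.\<close>

lemma alg_embedding_assoc_algebra:
  assumes B: "assoc_algebra R B" and h: "alg_embedding R Q B h"
  shows "assoc_algebra R Q"
proof -
  interpret B: assoc_algebra R B by (rule B)
  note h' = h[unfolded alg_embedding_def]
  have inj: "x = y" if "h x = h y" "x \<in> carrier Q" "y \<in> carrier Q" for x y
    using h' that by (auto dest: inj_onD)
  have hB [simp]: "h x \<in> carrier B" if "x \<in> carrier Q" for x using h' that by auto
  have mult [simp]: "x \<otimes>\<^bsub>Q\<^esub> y \<in> carrier Q" "h (x \<otimes>\<^bsub>Q\<^esub> y) = h x \<otimes>\<^bsub>B\<^esub> h y"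
    and add [simp]: "x \<oplus>\<^bsub>Q\<^esub> y \<in> carrier Q" "h (x \<oplus>\<^bsub>Q\<^esub> y) = h x \<oplus>\<^bsub>B\<^esub> h y"
    if "x \<in> carrier Q" "y \<in> carrier Q" for x y using h' that by auto
  have smult [simp]: "a \<odot>\<^bsub>Q\<^esub> x \<in> carrier Q" "h (a \<odot>\<^bsub>Q\<^esub> x) = a \<odot>\<^bsub>B\<^esub> h x"
    if "a \<in> carrier R" "x \<in> carrier Q" for a x using h' that by auto
  have one [simp]: "\<one>\<^bsub>Q\<^esub> \<in> carrier Q" "h \<one>\<^bsub>Q\<^esub> = \<one>\<^bsub>B\<^esub>"
    and zero [simp]: "\<zero>\<^bsub>Q\<^esub> \<in> carrier Q" "h \<zero>\<^bsub>Q\<^esub> = \<zero>\<^bsub>B\<^esub>" using h' by auto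
  have group: "abelian_group Q"
  proof (rule abelian_groupI)
    fix x assume x: "x \<in> carrier Q"
    \<comment> \<open>The additive inverse is the scalar multiple by -1.\<close>
    have "(\<ominus>\<^bsub>R\<^esub> \<one>\<^bsub>R\<^esub>) \<odot>\<^bsub>Q\<^esub> x \<oplus>\<^bsub>Q\<^esub> x = \<zero>\<^bsub>Q\<^esub>"
      using x by (intro inj) (auto simp: B.smult_l_minus B.M.l_neg)
    moreover have "(\<ominus>\<^bsub>R\<^esub> \<one>\<^bsub>R\<^esub>) \<odot>\<^bsub>Q\<^esub> x \<in> carrier Q" using x by simp
    ultimately show "\<exists>y\<in>carrier Q. y \<oplus>\<^bsub>Q\<^esub> x = \<zero>\<^bsub>Q\<^esub>" by blast
  qed (auto intro!: inj simp: B.M.a_assoc B.M.a_comm B.M.a_lcomm)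
  have "Module.module R Q"
    by (intro Module.module.intro module_axioms.intro B.R.is_cring group)
      (auto intro!: inj simp: B.smult_l_distr B.smult_r_distr B.smult_assoc1)
  moreover have "ring Q"
  proof (rule ringI[OF group])
    show "Group.monoid Q" by (rule monoidI) (auto intro!: inj simp: B.m_assoc)
  qed (auto intro!: inj simp: B.l_distr B.r_distr)
  ultimately show ?thesis
    by (intro assoc_algebra.intro assoc_algebra_axioms.intro)
      (auto intro!: inj simp: B.smult_mult_left B.smult_mult_right)
qed

text \<open>The isomorphism is \<open>h\<close> followed by the inverse of \<open>h'\<close>, which
  makes sense because the images agree.\<close>

lemma alg_embeddings_isomorphic:
  assumes B: "assoc_algebra R B"
    and h: "alg_embedding R Q B h" and h': "alg_embedding R Q' B h'"
    and range: "h ` carrier Q = h' ` carrier Q'"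
  shows "assoc_algebras_isomorphic R Q Q'"
proof -
  note d = h[unfolded alg_embedding_def] and d' = h'[unfolded alg_embedding_def]
  define f where "f = (\<lambda>x. inv_into (carrier Q') h' (h x))"
  have f: "f x \<in> carrier Q'" "h' (f x) = h x" if "x \<in> carrier Q" for x
  proof -
    have "h x \<in> h' ` carrier Q'" using that range by blast
    then show "f x \<in> carrier Q'" "h' (f x) = h x"
      unfolding f_def by (rule inv_into_into, rule f_inv_into_f)
  qed
  have inj': "x = y" if "h' x = h' y" "x \<in> carrier Q'" "y \<in> carrier Q'" for x y
    using d' that by (auto dest: inj_onD)
  have "bij_betw f (carrier Q) (carrier Q')"
  proof (rule bij_betw_imageI)
    show "inj_on f (carrier Q)"
      using d f(2) by (metis inj_on_def)
    show "f ` carrier Q = carrier Q'"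
    proof (intro equalityI subsetI)
      fix y assume y: "y \<in> carrier Q'"
      then obtain x where "x \<in> carrier Q" "h x = h' y" using range by (metis image_iff)
      with y f inj' show "y \<in> f ` carrier Q" by (metis image_eqI)
    qed (use f in auto)
  qed
  moreover have "f \<in> ring_hom Q Q'"
    using d d' f by (intro ring_hom_memI inj') auto
  moreover have "f (a \<odot>\<^bsub>Q\<^esub> x) = a \<odot>\<^bsub>Q'\<^esub> f x" if "a \<in> carrier R" "x \<in> carrier Q" for a x
    using d d' f that by (intro inj') auto
  ultimately have "f \<in> assoc_algebra_iso R Q Q'"
    by (simp add: assoc_algebra_iso_def ring_iso_def)
  then show ?thesis
    using alg_embedding_assoc_algebra[OF B h] alg_embedding_assoc_algebra[OF B h']
    by (auto simp: assoc_algebras_isomorphic_def)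
qed

section \<open>Quotients by kernels as images\<close>

lemma quot_algebra_simps:
  "carrier (quot_algebra M I) = a_rcosets\<^bsub>M\<^esub> I"
  "X \<otimes>\<^bsub>quot_algebra M I\<^esub> X' = rcoset_mult M I X X'"
  "\<one>\<^bsub>quot_algebra M I\<^esub> = I +>\<^bsub>M\<^esub> \<one>\<^bsub>M\<^esub>"
  "\<zero>\<^bsub>quot_algebra M I\<^esub> = I"
  "X \<oplus>\<^bsub>quot_algebra M I\<^esub> X' = X <+>\<^bsub>M\<^esub> X'"
  "a \<odot>\<^bsub>quot_algebra M I\<^esub> X = (\<Union>x\<in>X. I +>\<^bsub>M\<^esub> (a \<odot>\<^bsub>M\<^esub> x))"
  by (simp_all add: quot_algebra_def FactRing_def ring.extend_def module.fields_def)

text \<open>The cosets of the kernel are the fibres \<open>F x\<close> of \<phi>, so the coset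
  operations are well defined because \<phi> respects the operations. \<open>M\<close> is only
  required to carry an abelian group, as the star product on V is associative only modulo
  O(V).\<close>

lemma quot_algebra_kernel:
  fixes M :: "('r, 'a::ab_group_add) module" and B :: "('r, 'b) module"
  assumes B: "assoc_algebra R B"
    and M: "carrier M = UNIV" "\<And>x y. x \<oplus>\<^bsub>M\<^esub> y = x + y"
    and \<phi>: "\<And>x. \<phi> x \<in> carrier B"
      "\<And>x y. \<phi> (x + y) = \<phi> x \<oplus>\<^bsub>B\<^esub> \<phi> y"
      "\<And>x y. \<phi> (x \<otimes>\<^bsub>M\<^esub> y) = \<phi> x \<otimes>\<^bsub>B\<^esub> \<phi> y"
      "\<phi> \<one>\<^bsub>M\<^esub> = \<one>\<^bsub>B\<^esub>"
      "\<And>a x. a \<in> carrier R \<Longrightarrow> \<phi> (a \<odot>\<^bsub>M\<^esub> x) = a \<odot>\<^bsub>B\<^esub> \<phi> x"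
    and I: "I = {x. \<phi> x = \<zero>\<^bsub>B\<^esub>}"
  shows "alg_embedding R (quot_algebra M I) B (\<lambda>X. the_elem (\<phi> ` X))"
    and "(\<lambda>X. the_elem (\<phi> ` X)) ` carrier (quot_algebra M I) = range \<phi>"
proof -
  interpret B: assoc_algebra R B by (rule B)
  define F where "F = (\<lambda>x. {y. \<phi> y = \<phi> x})"
  have \<phi>_diff: "\<phi> (y - x) = b" if "\<phi> y = b \<oplus>\<^bsub>B\<^esub> \<phi> x" "b \<in> carrier B" for x y b
    using \<phi>(2)[of "y - x" x] that \<phi>(1) by (simp add: B.M.add.right_cancel)
  have coset: "I +>\<^bsub>M\<^esub> x = F x" for x
  proof (intro equalityI subsetI)
    fix y assume "y \<in> F x"
    then have "y - x \<in> I" using \<phi>(1) by (auto simp: F_def I intro!: \<phi>_diff)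
    moreover have "y = (y - x) + x" by simp
    ultimately show "y \<in> I +>\<^bsub>M\<^esub> x" unfolding a_r_coset_def' M by blast
  qed (auto simp: a_r_coset_def' M F_def I \<phi>(1) \<phi>(2))
  have elem: "the_elem (\<phi> ` F x) = \<phi> x" for x
  proof -
    have "\<phi> ` F x = {\<phi> x}" by (auto simp: F_def)
    then show ?thesis by simp
  qed
  have carrier: "carrier (quot_algebra M I) = range F"
    by (auto simp: quot_algebra_simps A_RCOSETS_def' M coset)
  have mult: "F x \<otimes>\<^bsub>quot_algebra M I\<^esub> F y = F (x \<otimes>\<^bsub>M\<^esub> y)" for x y
    by (auto simp: quot_algebra_simps rcoset_mult_def coset) (auto simp: F_def \<phi>(3))
  have add: "F x \<oplus>\<^bsub>quot_algebra M I\<^esub> F y = F (x + y)" for x y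
  proof (intro equalityI subsetI)
    fix z assume "z \<in> F (x + y)"
    then have "z - y \<in> F x" using \<phi>(1,2) by (auto simp: F_def intro!: \<phi>_diff)
    moreover have "z = (z - y) + y" "y \<in> F y" by (simp_all add: F_def)
    ultimately show "z \<in> F x \<oplus>\<^bsub>quot_algebra M I\<^esub> F y"
      unfolding quot_algebra_simps set_add_def' M by blast
  qed (auto simp: quot_algebra_simps set_add_def' M F_def \<phi>(2))
  have smult: "a \<odot>\<^bsub>quot_algebra M I\<^esub> F x = F (a \<odot>\<^bsub>M\<^esub> x)" if "a \<in> carrier R" for a x
    using that by (auto simp: quot_algebra_simps coset) (auto simp: F_def \<phi>(5))
  have "\<phi> 0 = \<zero>\<^bsub>B\<^esub>" using \<phi>_diff[of 0 "\<zero>\<^bsub>B\<^esub>" 0] \<phi>(1) by simp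
  then have zero: "\<zero>\<^bsub>quot_algebra M I\<^esub> = F 0"
    by (simp add: quot_algebra_simps F_def I)
  have one: "\<one>\<^bsub>quot_algebra M I\<^esub> = F \<one>\<^bsub>M\<^esub>" by (simp add: quot_algebra_simps coset)
  have inj: "inj_on (\<lambda>X. the_elem (\<phi> ` X)) (range F)"
    by (rule inj_onI) (auto simp: elem, auto simp: F_def)
  show "alg_embedding R (quot_algebra M I) B (\<lambda>X. the_elem (\<phi> ` X))"
    unfolding alg_embedding_def carrier
    using inj \<open>\<phi> 0 = \<zero>\<^bsub>B\<^esub>\<close> by (auto simp: mult add smult zero one elem \<phi>)
  show "(\<lambda>X. the_elem (\<phi> ` X)) ` carrier (quot_algebra M I) = range \<phi>"
    unfolding carrier by (auto simp: elem image_image)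
qed

text \<open>A linear endomorphism of \<open>\<complex>[L\<^sub>C]\<close> is represented by its values on the basis.\<close>

definition endo_algebra :: "(complex, 'b \<Rightarrow> 'b \<Rightarrow>\<^sub>0 complex) module" where
  "endo_algebra = \<lparr>carrier = UNIV, mult = (\<lambda>S T \<gamma>. lin_ext S (T \<gamma>)), one = (\<lambda>\<gamma>. Poly_Mapping.single \<gamma> 1),
     zero = (\<lambda>\<gamma>. 0), add = (\<lambda>S T \<gamma>. S \<gamma> + T \<gamma>), smult = (\<lambda>a S \<gamma>. a *\<^sub>p S \<gamma>)\<rparr>"

lemma cring_complex_ring: "cring complex_ring"
proof (rule cringI)
  show "abelian_group complex_ring"
    by (rule abelian_groupI) (auto simp: complex_ring_def intro: exI[of _ "- _"])
  show "comm_monoid complex_ring"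
    by (rule comm_monoidI) (auto simp: complex_ring_def)
qed (auto simp: complex_ring_def algebra_simps)

lemma assoc_algebra_endo_algebra: "assoc_algebra complex_ring endo_algebra"
proof -
  have group: "abelian_group endo_algebra"
  proof (rule abelian_groupI)
    fix x :: "'b \<Rightarrow> 'b \<Rightarrow>\<^sub>0 complex"
    show "\<exists>y\<in>carrier endo_algebra. y \<oplus>\<^bsub>endo_algebra\<^esub> x = \<zero>\<^bsub>endo_algebra\<^esub>"
      by (rule bexI[of _ "\<lambda>\<gamma>. - x \<gamma>"]) (simp_all add: endo_algebra_def)
  qed (auto simp: endo_algebra_def add_ac)
  have "Module.module complex_ring endo_algebra"
    by (intro Module.module.intro module_axioms.intro cring_complex_ring group)
      (auto simp: endo_algebra_def complex_ring_def pm.scale_left_distrib pm.scale_right_distrib)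
  moreover have "ring endo_algebra"
  proof (rule ringI[OF group])
    show "Group.monoid endo_algebra"
      by (rule monoidI) (auto simp: endo_algebra_def lin_ext_lin_ext)
  qed (auto simp: endo_algebra_def lin_ext_fun_add lin_ext_add)
  ultimately show ?thesis
    by (intro assoc_algebra.intro assoc_algebra_axioms.intro)
      (auto simp: endo_algebra_def lin_ext_fun_scale lin_ext_scale)
qed

theorem proposition6p2:
  fixes k :: int
  assumes "k \<noteq> 0"
  shows "assoc_algebras_isomorphic complex_ring
           (zhu_algebra k :: (complex, 'n::finite voa set) module)
           (algebra_A k :: (complex, 'n gen free_alg set) module)"
proof -
  let ?\<Phi> = "\<lambda>(u :: 'n voa) \<gamma>. top_act k \<gamma> u" and ?\<Psi> = "\<lambda>(f :: 'n gen free_alg) \<gamma>. free_act k \<gamma> f"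
  \<comment> \<open>Both instances use the same operators \<open>top_op k\<close>; the assumption on
    \<open>k\<close> enters through their independence.\<close>
  note zhu = kernel_and_range[where \<Phi> = "top_act k" and T = "top_op k" and b = d_monomial and J = "zhu_O k :: 'n voa set",
      OF top_act_linear subspace_zhu_O top_act_zhu_O d_monomials_span top_act_d_monomial
        top_op_independent[OF assms]]
  note free = kernel_and_range[where \<Phi> = "free_act k" and T = "top_op k" and b = normal_word
      and J = "rel_ideal k :: 'n gen free_alg set",
      OF free_act_linear subspace_rel_ideal free_act_rel_ideal normal_words_span free_act_normal_word
        top_op_independent[OF assms]]
  have Z: "zhu_O k = {u. ?\<Phi> u = \<zero>\<^bsub>endo_algebra\<^esub>}"
    using zhu(1) by (auto simp: endo_algebra_def fun_eq_iff)
  have F: "rel_ideal k = {f. ?\<Psi> f = \<zero>\<^bsub>endo_algebra\<^esub>}"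
    using free(1) by (auto simp: endo_algebra_def fun_eq_iff)
  have one_zhu: "top_act k \<gamma> (gexp 0) = Poly_Mapping.single \<gamma> 1" for \<gamma> :: "'n latC"
    by (simp add: gexp_def top_basis_def)
  have one_free: "free_act k \<gamma> 1 = Poly_Mapping.single \<gamma> 1" for \<gamma> :: "'n latC"
    by (simp add: zero_free_monoid_def flip: single_one)
  note Q = quot_algebra_kernel[where M = "zhu_pre k" and \<phi> = ?\<Phi>, OF assoc_algebra_endo_algebra _ _ _ _ _ _ _ Z]
  note Q' = quot_algebra_kernel[where M = free_algebra and \<phi> = ?\<Psi>, OF assoc_algebra_endo_algebra _ _ _ _ _ _ _ F]
  show ?thesis
    unfolding zhu_algebra_def algebra_A_def
  proof (rule alg_embeddings_isomorphic[OF assoc_algebra_endo_algebra])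
    show "alg_embedding complex_ring (quot_algebra (zhu_pre k) (zhu_O k)) endo_algebra (\<lambda>X. the_elem (?\<Phi> ` X))"
      by (rule Q(1)) (simp_all add: zhu_pre_def endo_algebra_def one_zhu top_act_add top_act_scale top_act_zhu_mult)
    show "alg_embedding complex_ring (quot_algebra free_algebra (rel_ideal k)) endo_algebra (\<lambda>X. the_elem (?\<Psi> ` X))"
      by (rule Q'(1)) (simp_all add: endo_algebra_def one_free free_act_mult
          pm_linear_add[OF free_act_linear] pm_linear_scale[OF free_act_linear])
    have "(\<lambda>X. the_elem (?\<Phi> ` X)) ` carrier (quot_algebra (zhu_pre k) (zhu_O k)) = range ?\<Phi>"
      by (rule Q(2)) (simp_all add: zhu_pre_def endo_algebra_def one_zhu top_act_add top_act_scale top_act_zhu_mult)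
    \<comment> \<open>Both ranges consist of the linear combinations of the operators
      \<open>top_op k\<close>.\<close>
    also have "\<dots> = range ?\<Psi>"
      using zhu(2) free(2) by simp
    also have "\<dots> = (\<lambda>X. the_elem (?\<Psi> ` X)) ` carrier (quot_algebra free_algebra (rel_ideal k))"
      by (rule Q'(2)[symmetric]) (simp_all add: endo_algebra_def one_free free_act_mult
          pm_linear_add[OF free_act_linear] pm_linear_scale[OF free_act_linear])
    finally show "(\<lambda>X. the_elem (?\<Phi> ` X)) ` carrier (quot_algebra (zhu_pre k) (zhu_O k))
      = (\<lambda>X. the_elem (?\<Psi> ` X)) ` carrier (quot_algebra free_algebra (rel_ideal k))" .
  qed
qed

end
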